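(* Let $n,r\ge1$, $A_{-1}\in\mathbb{R}^{n\times n}$, $B\in\mathbb{R}^{n\times r}$, and let $A_2,A_3$ be $n\times n$ matrix functions on $[-1,0]$ with entries in $L_2([-1,0],\mathbb{C})$. Consider the neutral type system $$\dot z(t)=A_{-1}\dot z(t-1)+\int_{-1}^0A_2(\theta)\dot z(t+\theta)\,d\theta+\int_{-1}^0A_3(\theta)z(t+\theta)\,d\theta+Bu(t)$$ and its operator model $\dot x=\mathcal A x+\mathcal B u$ on $M_2$ described in the context. Let $$\Delta_{\mathcal A}(\lambda)=\lambda I-\lambda e^{-\lambda}A_{-1}-\lambda\int_{-1}^0e^{\lambda s}A_2(s)\,ds-\int_{-1}^0e^{\lambda s}A_3(s)\,ds.$$ If there exist $\lambda\in\mathbb{C}$ and $y\in\mathbb{C}^n\setminus\{0\}$ such that $\Delta_{\mathcal A}(\lambda)^*y=0$ and $B^*y=0$, then the system is not exactly controllable at any time $T>0$, i.e. $\mathcal R_T\neq\mathcal D(\mathcal A)$ for every $T>0$.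
   Context: The state space is $M_2=\mathbb{C}^n\times L_2(-1,0;\mathbb{C}^n)$. The operator $\mathcal A$ is defined by $\mathcal A(y,z(\cdot))=\big(Lz,\ \tfrac{d}{d\theta}z\big)$, where $Lz=\int_{-1}^0A_2(\theta)z'(\theta)\,d\theta+\int_{-1}^0A_3(\theta)z(\theta)\,d\theta$, on the domain $\mathcal D(\mathcal A)=\{(y,z(\cdot))\in M_2: z\in H^1(-1,0;\mathbb{C}^n),\ y=z(0)-A_{-1}z(-1)\}$; $\mathcal A$ generates a $C_0$-semigroup $e^{\mathcal At}$ on $M_2$. The control operator is $\mathcal Bu=(Bu,0)$ for $u\in\mathbb{C}^r$. The reachability set from $0$ at time $T$ is $\mathcal R_T=\{\int_0^Te^{\mathcal At}\mathcal Bu(t)\,dt: u\in L_2(0,T;\mathbb{C}^r)\}$. The system is exactly controllable at time $T$ if $\mathcal R_T=\mathcal D(\mathcal A)$. *)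

theory Defs
  imports "HOL-Analysis.Analysis"
begin

text \<open>Elements of M2 = C^n x L2(-1,0;C^n) are represented by pairs (y, z) of a vector
  and a function; two representatives denote the same element iff they agree a.e. on [-1,0].\<close>

type_synonym 'n m2 = "(complex^'n) \<times> (real \<Rightarrow> complex^'n)"

definition L2_on :: "real set \<Rightarrow> (real \<Rightarrow> 'a::euclidean_space) \<Rightarrow> bool" where
  "L2_on S f \<longleftrightarrow> set_borel_measurable lebesgue S f \<and>
                  set_integrable lebesgue S (\<lambda>x. (norm (f x))^2)"

definition in_M2 :: "'n::finite m2 \<Rightarrow> bool" where
  "in_M2 x \<longleftrightarrow> L2_on {-1..0} (snd x)"

definition m2_equiv :: "'n::finite m2 \<Rightarrow> 'n m2 \<Rightarrow> bool" where
  "m2_equiv x x' \<longleftrightarrow> fst x = fst x' \<and>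
      (AE \<theta> in lebesgue. \<theta> \<in> {-1..0} \<longrightarrow> snd x \<theta> = snd x' \<theta>)"

definition cvscale :: "complex \<Rightarrow> complex^'n \<Rightarrow> complex^'n" where
  "cvscale c v = (\<chi> i. c * v $ i)"

definition m2_add :: "'n::finite m2 \<Rightarrow> 'n m2 \<Rightarrow> 'n m2" where
  "m2_add x x' = (fst x + fst x', \<lambda>\<theta>. snd x \<theta> + snd x' \<theta>)"

definition m2_diff :: "'n::finite m2 \<Rightarrow> 'n m2 \<Rightarrow> 'n m2" where
  "m2_diff x x' = (fst x - fst x', \<lambda>\<theta>. snd x \<theta> - snd x' \<theta>)"

definition m2_scale :: "complex \<Rightarrow> 'n::finite m2 \<Rightarrow> 'n m2" where
  "m2_scale c x = (cvscale c (fst x), \<lambda>\<theta>. cvscale c (snd x \<theta>))"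

definition m2_norm :: "'n::finite m2 \<Rightarrow> real" where
  "m2_norm x = sqrt ((norm (fst x))^2 + (LINT \<theta>:{-1..0}|lebesgue. (norm (snd x \<theta>))^2))"

definition m2_inner :: "'n::finite m2 \<Rightarrow> 'n m2 \<Rightarrow> complex" where
  "m2_inner x x' = (\<Sum>i\<in>UNIV. fst x $ i * cnj (fst x' $ i)) +
      (LINT \<theta>:{-1..0}|lebesgue. (\<Sum>i\<in>UNIV. snd x \<theta> $ i * cnj (snd x' \<theta> $ i)))"

definition cmat :: "real^'m^'n \<Rightarrow> complex^'m^'n" where
  "cmat M = (\<chi> i j. complex_of_real (M $ i $ j))"

definition cadj :: "complex^'m^'n \<Rightarrow> complex^'n^'m" where
  "cadj M = (\<chi> i j. cnj (M $ j $ i))"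

text \<open>The operator A: relation between x in D(A) and A x (A x is determined up to m2_equiv).
  z in H^1 means z agrees a.e. with zh(theta) = c + int_{-1}^theta w, w in L2; then z' = w.\<close>

definition opA_rel :: "real^'n^'n \<Rightarrow> (real \<Rightarrow> complex^'n^'n) \<Rightarrow> (real \<Rightarrow> complex^'n^'n)
     \<Rightarrow> 'n::finite m2 \<Rightarrow> 'n m2 \<Rightarrow> bool" where
  "opA_rel Am1 A2 A3 x v \<longleftrightarrow> in_M2 x \<and>
     (\<exists>c w. L2_on {-1..0} w \<and>
        (let zh = (\<lambda>\<theta>. c + integral {-1..\<theta>} w) in
           (AE \<theta> in lebesgue. \<theta> \<in> {-1..0} \<longrightarrow> snd x \<theta> = zh \<theta>) \<and>
           fst x = zh 0 - cmat Am1 *v zh (-1) \<and>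
           fst v = integral {-1..0} (\<lambda>\<theta>. A2 \<theta> *v w \<theta>)
                   + integral {-1..0} (\<lambda>\<theta>. A3 \<theta> *v zh \<theta>) \<and>
           snd v = w))"

definition dom_A :: "real^'n^'n \<Rightarrow> (real \<Rightarrow> complex^'n^'n) \<Rightarrow> (real \<Rightarrow> complex^'n^'n)
     \<Rightarrow> 'n::finite m2 set" where
  "dom_A Am1 A2 A3 = {x. \<exists>v. opA_rel Am1 A2 A3 x v}"

text \<open>C0-semigroup on M2 (acting on representatives, compatible with m2_equiv).\<close>

definition is_C0_semigroup :: "(real \<Rightarrow> 'n::finite m2 \<Rightarrow> 'n m2) \<Rightarrow> bool" where
  "is_C0_semigroup S \<longleftrightarrow>
     (\<forall>t\<ge>0. \<forall>x. in_M2 x \<longrightarrow> in_M2 (S t x)) \<and>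
     (\<forall>t\<ge>0. \<forall>x x'. in_M2 x \<and> in_M2 x' \<and> m2_equiv x x' \<longrightarrow> m2_equiv (S t x) (S t x')) \<and>
     (\<forall>t\<ge>0. \<forall>x x' a b. in_M2 x \<and> in_M2 x' \<longrightarrow>
        m2_equiv (S t (m2_add (m2_scale a x) (m2_scale b x')))
                 (m2_add (m2_scale a (S t x)) (m2_scale b (S t x')))) \<and>
     (\<forall>t\<ge>0. \<exists>M. \<forall>x. in_M2 x \<longrightarrow> m2_norm (S t x) \<le> M * m2_norm x) \<and>
     (\<forall>x. in_M2 x \<longrightarrow> m2_equiv (S 0 x) x) \<and>
     (\<forall>t\<ge>0. \<forall>s\<ge>0. \<forall>x. in_M2 x \<longrightarrow> m2_equiv (S (t + s) x) (S t (S s x))) \<and>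
     (\<forall>x. in_M2 x \<longrightarrow> ((\<lambda>t. m2_norm (m2_diff (S t x) x)) \<longlongrightarrow> 0) (at_right 0))"

definition generated_by_A :: "real^'n^'n \<Rightarrow> (real \<Rightarrow> complex^'n^'n) \<Rightarrow> (real \<Rightarrow> complex^'n^'n)
     \<Rightarrow> (real \<Rightarrow> 'n::finite m2 \<Rightarrow> 'n m2) \<Rightarrow> bool" where
  "generated_by_A Am1 A2 A3 S \<longleftrightarrow> is_C0_semigroup S \<and>
     (\<forall>x v. in_M2 x \<and> in_M2 v \<longrightarrow>
        (((\<lambda>t. m2_norm (m2_diff (m2_scale (complex_of_real (1 / t)) (m2_diff (S t x) x)) v))
            \<longlongrightarrow> 0) (at_right 0)
         \<longleftrightarrow> (\<exists>v'. opA_rel Am1 A2 A3 x v' \<and> m2_equiv v v')))"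

text \<open>Reachable set R_T: x = int_0^T S(t) (B u(t), 0) dt, the (Bochner) integral being
  characterised by its pairings with all elements of M2.\<close>

definition reach_set :: "(real \<Rightarrow> 'n::finite m2 \<Rightarrow> 'n m2) \<Rightarrow> real^'r::finite^'n \<Rightarrow> real
     \<Rightarrow> 'n m2 set" where
  "reach_set S B T = {x. in_M2 x \<and>
     (\<exists>u :: real \<Rightarrow> complex^'r. L2_on {0..T} u \<and>
        (\<forall>\<psi>. in_M2 \<psi> \<longrightarrow>
           m2_inner x \<psi> = (LINT t:{0..T}|lebesgue. m2_inner (S t (cmat B *v u t, \<lambda>_. 0)) \<psi>)))}"

definition Delta_A :: "real^'n^'n \<Rightarrow> (real \<Rightarrow> complex^'n^'n) \<Rightarrow> (real \<Rightarrow> complex^'n^'n)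
     \<Rightarrow> complex \<Rightarrow> complex^'n^'n" where
  "Delta_A Am1 A2 A3 lam = (\<chi> i j. (if i = j then lam else 0)
       - lam * exp (- lam) * complex_of_real (Am1 $ i $ j)
       - lam * integral {-1..0} (\<lambda>s. exp (lam * complex_of_real s) * A2 s $ i $ j)
       - integral {-1..0} (\<lambda>s. exp (lam * complex_of_real s) * A3 s $ i $ j))"

end

theory Submission
  imports Defs
begin

text \<open>
  The hypothesis on y yields an eigenvector \<psi> = (y, \<psi>2) of the adjoint of A: integration by parts
  reduces (A x, \<psi>) = lam (x, \<psi>) to a linear first-order equation for q = conj \<psi>2 + y* A2 with data
  q(0) = lam y* and q(-1) = lam y* A_{-1}, and these two conditions are compatible exactly
  when y* \<Delta>(lam) = 0. Hence t \<mapsto> (S(t) x, \<psi>) has right derivative lam (S(t) x, \<psi>) for x in D(A);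
  it is continuous because S is uniformly bounded near 0 (a gliding hump argument), so it equals
  exp(lam t) (x, \<psi>). By density this holds for x = (B u, 0), where the pairing is (B u, y) = 0. So the
  reachable set is orthogonal to \<psi>, while the elements (y, (1 + \<theta>)^k y) of D(A) have pairings
  with \<psi> that converge to |y|^2.
\<close>

subsection \<open>Integration by parts for absolutely continuous functions\<close>

text \<open>Three obstacles shape the argument. \<open>A2\<close> is only square integrable, so
  \<psi>2 need not be absolutely continuous and cannot itself be integrated by parts; the
  combination q can. The control vectors (B u, 0) lie outside D(A) unless B u = 0, because a second
  component that vanishes almost everywhere forces both boundary values to be zero; the exponential
  law has to be proved on D(A) and carried over by approximation. The generator is a limit from the
  right, so only a right derivative of the pairing is available, and it determines a function only
  when continuity from the left is known as well; this is what calls for a bound on S(s) that is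
  uniform in s. Elements of M2 are representatives rather than classes, so completeness and uniform
  boundedness are proved for \<open>m2_norm\<close> directly. The profiles (1 + \<theta>)^k b vanish
  at -1 and equal b at 0, hence satisfy the boundary condition for every A_{-1}, and their L2 norm
  tends to 0; they serve both the approximation and the final counterexample.\<close>

lemma AE_eq_borel_complex:
  fixes f :: "real \<Rightarrow> complex"
  assumes "integrable lebesgue f"
  shows "\<exists>g\<in>borel_measurable lborel. (AE x in lborel. f x = g x)"
proof -
  have m: "f \<in> borel_measurable lebesgue" using assms by simp
  have r: "(\<lambda>x. Re (f x)) \<in> borel_measurable (completion lborel)"
   and i: "(\<lambda>x. Im (f x)) \<in> borel_measurable (completion lborel)"
    using m by auto
  from completion_ex_borel_measurable_real[OF r] obtain u where u: "u \<in> borel_measurable lborel" "AE x in lborel. Re (f x) = u x" by auto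
  from completion_ex_borel_measurable_real[OF i] obtain v where v: "v \<in> borel_measurable lborel" "AE x in lborel. Im (f x) = v x" by auto
  have 1: "(\<lambda>x. Complex (u x) (v x)) \<in> borel_measurable lborel"
    using u(1) v(1) by (simp add: borel_measurable_complex_iff)
  have "AE x in lborel. f x = Complex (u x) (v x)"
    using u(2) v(2) by eventually_elim (simp add: complex_eq_iff)
  then show ?thesis using 1 by (rule bexI)
qed

text \<open>Fubini for f(x) g(y) on the plane, split along the diagonal. One half is closed and the
  other open, so that the two are disjoint and exhaust the plane; no derivative occurs.\<close>

lemma integral_by_parts_lborel:
  fixes f g :: "real \<Rightarrow> complex"
  assumes f: "integrable lborel f" and g: "integrable lborel g"
  shows "(LINT x|lborel. f x * (LINT y:{..x}|lborel. g y)) + (LINT y|lborel. (LINT x:{..<y}|lborel. f x) * g y)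
     = integral\<^sup>L lborel f * integral\<^sup>L lborel g"
proof -
  have [measurable]: "f \<in> borel_measurable borel" "g \<in> borel_measurable borel"
    using f g by auto
  have int: "integrable (lborel \<Otimes>\<^sub>M lborel) (\<lambda>(x,y). f x * g y)"
  proof (rule lborel_pair.Fubini_integrable)
    have "integrable lborel (\<lambda>x. norm (f x) * integral\<^sup>L lborel (\<lambda>y. norm (g y)))"
      using f by simp
    then show "integrable lborel (\<lambda>x. LINT y|lborel. norm (case (x, y) of (x, y) \<Rightarrow> f x * g y))"
      by (simp add: norm_mult)
    show "AE x in lborel. integrable lborel (\<lambda>y. case (x, y) of (x, y) \<Rightarrow> f x * g y)"
      using g by simp
  qed simp
  have i1: "integrable (lborel \<Otimes>\<^sub>M lborel) (\<lambda>(x,y). indicator {..x} y *\<^sub>R (f x * g y))"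
    by (rule Bochner_Integration.integrable_bound[OF int]) (auto simp: norm_mult indicator_def)
  have i2: "integrable (lborel \<Otimes>\<^sub>M lborel) (\<lambda>(x,y). indicator {..<y} x *\<^sub>R (f x * g y))"
    by (rule Bochner_Integration.integrable_bound[OF int]) (auto simp: norm_mult indicator_def)
  have "integral\<^sup>L lborel f * integral\<^sup>L lborel g = (LINT x|lborel. LINT y|lborel. f x * g y)"
    by simp
  also have "\<dots> = integral\<^sup>L (lborel \<Otimes>\<^sub>M lborel) (\<lambda>(x,y). f x * g y)"
    using lborel_pair.integral_fst'[OF int] by simp
  also have "\<dots> = integral\<^sup>L (lborel \<Otimes>\<^sub>M lborel) (\<lambda>p. (case p of (x,y) \<Rightarrow> indicator {..x} y *\<^sub>R (f x * g y))
       + (case p of (x,y) \<Rightarrow> indicator {..<y} x *\<^sub>R (f x * g y)))"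
    by (rule Bochner_Integration.integral_cong) (auto simp: indicator_def)
  also have "\<dots> = integral\<^sup>L (lborel \<Otimes>\<^sub>M lborel) (\<lambda>(x,y). indicator {..x} y *\<^sub>R (f x * g y))
     + integral\<^sup>L (lborel \<Otimes>\<^sub>M lborel) (\<lambda>(x,y). indicator {..<y} x *\<^sub>R (f x * g y))"
    by (rule Bochner_Integration.integral_add[OF i1 i2])
  also have "integral\<^sup>L (lborel \<Otimes>\<^sub>M lborel) (\<lambda>(x,y). indicator {..x} y *\<^sub>R (f x * g y)) =
      (LINT x|lborel. LINT y|lborel. indicator {..x} y *\<^sub>R (f x * g y))"
    using lborel_pair.integral_fst'[OF i1] by simp
  also have "\<dots> = (LINT x|lborel. f x * (LINT y:{..x}|lborel. g y))"
    unfolding set_lebesgue_integral_def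
    by (simp flip: mult_scaleR_right)
  also have "integral\<^sup>L (lborel \<Otimes>\<^sub>M lborel) (\<lambda>(x,y). indicator {..<y} x *\<^sub>R (f x * g y)) =
      (LINT y|lborel. LINT x|lborel. indicator {..<y} x *\<^sub>R (f x * g y))"
    using lborel_pair.integral_snd[OF i2] by simp
  also have "\<dots> = (LINT y|lborel. (LINT x:{..<y}|lborel. f x) * g y)"
    unfolding set_lebesgue_integral_def
    by (simp flip: mult_scaleR_left)
  finally show ?thesis by simp
qed

lemma absolutely_integrable_mult_continuous:
  fixes h k :: "real \<Rightarrow> complex"
  assumes h: "h absolutely_integrable_on {a..b}" and k: "continuous_on {a..b} k"
  shows "(\<lambda>x. h x * k x) absolutely_integrable_on {a..b}"
proof -
  have "(\<lambda>x. k x * h x) absolutely_integrable_on {a..b}"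
  proof (rule absolutely_integrable_bounded_measurable_product[where h="(*)" and f=k and g=h])
    show "bilinear ((*) :: complex \<Rightarrow> complex \<Rightarrow> complex)"
      by (simp add: bilinear_conv_bounded_bilinear bounded_bilinear_mult)
    show "k \<in> borel_measurable (lebesgue_on {a..b})"
      using k by (simp add: continuous_imp_measurable_on_sets_lebesgue)
    show "bounded (k ` {a..b})"
      using k by (intro compact_imp_bounded compact_continuous_image) auto
  qed (use h in simp_all)
  then show ?thesis by (simp add: mult.commute)
qed

lemma continuous_on_integral_absolutely_integrable:
  fixes h :: "real \<Rightarrow> complex"
  assumes "h absolutely_integrable_on {a..b}"
  shows "continuous_on {a..b} (\<lambda>x. integral {a..x} h)"
  using assms by (intro indefinite_integral_continuous_1) (simp add: absolutely_integrable_on_def)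

text \<open>Fubini is applied to Borel functions, while f and g are only Lebesgue measurable. Both
  are cut off outside [a,b], replaced by Borel functions that agree with them almost everywhere, and
  the resulting identity is translated back.\<close>

lemma integral_by_parts_absolutely_integrable:
  fixes f g :: "real \<Rightarrow> complex"
  assumes f: "f absolutely_integrable_on {a..b}" and g: "g absolutely_integrable_on {a..b}"
  shows "integral {a..b} (\<lambda>x. f x * integral {a..x} g) + integral {a..b} (\<lambda>y. integral {a..y} f * g y)
     = integral {a..b} f * integral {a..b} g"
proof -
  define f0 where "f0 x = indicator {a..b} x *\<^sub>R f x" for x
  define g0 where "g0 x = indicator {a..b} x *\<^sub>R g x" for x
  have f0: "integrable lebesgue f0" and g0: "integrable lebesgue g0"
    using f g unfolding f0_def g0_def set_integrable_def by auto
  obtain f1 where f1m[measurable]: "f1 \<in> borel_measurable borel" and f1: "AE x in lborel. f0 x = f1 x"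
    using AE_eq_borel_complex[OF f0] by auto
  obtain g1 where g1m[measurable]: "g1 \<in> borel_measurable borel" and g1: "AE x in lborel. g0 x = g1 x"
    using AE_eq_borel_complex[OF g0] by auto
  have "integrable lebesgue f1"
    by (rule integrable_cong_AE_imp[OF f0 _ AE_completion[OF f1]]) (rule measurable_completion, simp)
  then have If: "integrable lborel f1" by (simp add: integrable_completion)
  have "integrable lebesgue g1"
    by (rule integrable_cong_AE_imp[OF g0 _ AE_completion[OF g1]]) (rule measurable_completion, simp)
  then have Ig: "integrable lborel g1" by (simp add: integrable_completion)
  \<comment> \<open>The cut-off turns a half-line into [a,x], and the point x is a null set; one
    statement therefore covers the closed and the open half-line of the Fubini identity.\<close>
  have key: "(LINT y:X|lborel. h1 y) = integral {a..x} h"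
    if h: "h absolutely_integrable_on {a..b}" and x: "x \<in> {a..b}" and X: "X = {..x} \<or> X = {..<x}"
      and h0: "h0 = (\<lambda>x. indicator {a..b} x *\<^sub>R h x)"
      and h1m[measurable]: "h1 \<in> borel_measurable borel" and h1: "AE x in lborel. h0 x = h1 x"
    for h h0 h1 :: "real \<Rightarrow> complex" and x X
  proof -
    have Xm [measurable]: "X \<in> sets borel" using X by auto
    have hx: "h absolutely_integrable_on {a..x}"
      by (rule set_integrable_subset[OF h]) (use x in auto)
    have "(LINT y:X|lborel. h1 y) = (LINT y:X|lebesgue. h1 y)"
      unfolding set_lebesgue_integral_def by (rule integral_completion[symmetric]) simp
    also have "\<dots> = (LINT y:{a..x}|lebesgue. h y)"
      unfolding set_lebesgue_integral_def
    proof (rule integral_cong_AE)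
      show "(\<lambda>y. indicat_real X y *\<^sub>R h1 y) \<in> borel_measurable lebesgue"
        by (rule measurable_completion) simp
      show "(\<lambda>y. indicat_real {a..x} y *\<^sub>R h y) \<in> borel_measurable lebesgue"
        using hx unfolding set_integrable_def by simp
      have "AE y in lebesgue. h0 y = h1 y" using h1 by (rule AE_completion)
      moreover have "AE y in lebesgue. y \<noteq> x" by (intro AE_completion AE_lborel_singleton)
      ultimately show "AE y in lebesgue. indicat_real X y *\<^sub>R h1 y = indicat_real {a..x} y *\<^sub>R h y"
        by eventually_elim (use X x in \<open>auto simp: h0 indicator_def split: if_splits\<close>)
    qed
    also have "\<dots> = integral {a..x} h" by (rule set_lebesgue_integral_eq_integral(2)[OF hx])
    finally show ?thesis .
  qed
  have tot: "integral\<^sup>L lborel h1 = integral {a..b} h"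
    if h: "h absolutely_integrable_on {a..b}"
      and h0: "h0 = (\<lambda>x. indicator {a..b} x *\<^sub>R h x)"
      and h1m[measurable]: "h1 \<in> borel_measurable borel" and h1: "AE x in lborel. h0 x = h1 x"
    for h h0 h1 :: "real \<Rightarrow> complex"
  proof -
    have "integral\<^sup>L lborel h1 = integral\<^sup>L lebesgue h1"
      by (rule integral_completion[symmetric]) simp
    also have "\<dots> = integral\<^sup>L lebesgue (\<lambda>x. indicator {a..b} x *\<^sub>R h x)"
    proof (rule integral_cong_AE)
      show "h1 \<in> borel_measurable lebesgue" by (rule measurable_completion) simp
      show "(\<lambda>y. indicat_real {a..b} y *\<^sub>R h y) \<in> borel_measurable lebesgue"
        using h unfolding set_integrable_def by simp
      show "AE y in lebesgue. h1 y = indicat_real {a..b} y *\<^sub>R h y"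
        using AE_completion[OF h1] unfolding h0 by eventually_elim simp
    qed
    also have "\<dots> = integral {a..b} h"
      using set_lebesgue_integral_eq_integral(2)[OF h] by (simp add: set_lebesgue_integral_def)
    finally show ?thesis .
  qed
  \<comment> \<open>\<open>K\<close> is a Borel function on the whole line that equals the
    indefinite integral \<open>k\<close> on [a,b]; outside, \<open>h0\<close> is zero, so the values
    of \<open>K\<close> there have no influence.\<close>
  have outer: "(LINT x|lborel. h1 x * K x) = integral {a..b} (\<lambda>x. h x * k x)"
    if h: "h absolutely_integrable_on {a..b}" and k: "continuous_on {a..b} k"
      and h0: "h0 = (\<lambda>x. indicator {a..b} x *\<^sub>R h x)"
      and h1m[measurable]: "h1 \<in> borel_measurable borel" and h1: "AE x in lborel. h0 x = h1 x"
      and Km[measurable]: "K \<in> borel_measurable borel" and K: "\<And>x. x \<in> {a..b} \<Longrightarrow> K x = k x"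
    for h h0 h1 k K :: "real \<Rightarrow> complex"
  proof (rule tot[OF absolutely_integrable_mult_continuous[OF h k] refl])
    show "AE x in lborel. indicat_real {a..b} x *\<^sub>R (h x * k x) = h1 x * K x"
      using h1 by eventually_elim (auto simp: h0 indicator_def K split: if_splits)
  qed simp
  have "(LINT x|lborel. f1 x * (LINT y:{..x}|lborel. g1 y)) = integral {a..b} (\<lambda>x. f x * integral {a..x} g)"
  proof (rule outer[OF f continuous_on_integral_absolutely_integrable[OF g] _ f1m f1])
    show "(\<lambda>x. LINT y:{..x}|lborel. g1 y) \<in> borel_measurable borel"
      unfolding set_lebesgue_integral_def indicator_def by simp
    show "(LINT y:{..x}|lborel. g1 y) = integral {a..x} g" if "x \<in> {a..b}" for x
      by (rule key[OF g that _ _ g1m g1]) (auto simp: g0_def[abs_def])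
  qed (simp add: f0_def[abs_def])
  moreover have "(LINT x|lborel. g1 x * (LINT y:{..<x}|lborel. f1 y)) = integral {a..b} (\<lambda>x. g x * integral {a..x} f)"
  proof (rule outer[OF g continuous_on_integral_absolutely_integrable[OF f] _ g1m g1])
    show "(\<lambda>x. LINT y:{..<x}|lborel. f1 y) \<in> borel_measurable borel"
      unfolding set_lebesgue_integral_def indicator_def by simp
    show "(LINT y:{..<x}|lborel. f1 y) = integral {a..x} f" if "x \<in> {a..b}" for x
      by (rule key[OF f that _ _ f1m f1]) (auto simp: f0_def[abs_def])
  qed (simp add: g0_def[abs_def])
  moreover have "integral\<^sup>L lborel f1 = integral {a..b} f" "integral\<^sup>L lborel g1 = integral {a..b} g"
    using tot[OF f _ f1m f1] tot[OF g _ g1m g1] by (auto simp: f0_def[abs_def] g0_def[abs_def])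
  ultimately show ?thesis using integral_by_parts_lborel[OF If Ig] by (simp add: mult.commute)
qed

text \<open>Absolute continuity in integral form. The density f is carried as an argument, so the
  product rule can name its integrand and no almost-everywhere derivative has to be
  extracted.\<close>

definition AC_with :: "real \<Rightarrow> real \<Rightarrow> (real \<Rightarrow> complex) \<Rightarrow> (real \<Rightarrow> complex) \<Rightarrow> bool" where
  "AC_with a b F f \<longleftrightarrow> f absolutely_integrable_on {a..b} \<and> (\<forall>t\<in>{a..b}. F t = F a + integral {a..t} f)"

lemma AC_with_continuous: "AC_with a b F f \<Longrightarrow> continuous_on {a..b} F"
proof -
  assume F: "AC_with a b F f"
  have "continuous_on {a..b} (\<lambda>t. F a + integral {a..t} f)"
    using F[unfolded AC_with_def] by (intro continuous_intros continuous_on_integral_absolutely_integrable) blast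
  then show ?thesis
    by (rule continuous_on_eq) (use F[unfolded AC_with_def] in metis)
qed

text \<open>Expanding F and G around their values at a leaves, besides terms linear in the
  densities, exactly the two mixed integrals of the integration by parts formula.\<close>

lemma AC_with_mult:
  assumes F: "AC_with a b F f" and G: "AC_with a b G g"
  shows "AC_with a b (\<lambda>t. F t * G t) (\<lambda>t. f t * G t + F t * g t)"
proof -
  have f: "f absolutely_integrable_on {a..b}" and g: "g absolutely_integrable_on {a..b}"
    using F G unfolding AC_with_def by blast+
  have fG: "(\<lambda>t. f t * G t) absolutely_integrable_on {a..b}"
    by (rule absolutely_integrable_mult_continuous[OF f AC_with_continuous[OF G]])
  have Fg: "(\<lambda>t. F t * g t) absolutely_integrable_on {a..b}"
    using absolutely_integrable_mult_continuous[OF g AC_with_continuous[OF F]] by (simp add: mult.commute)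
  have "F t * G t = F a * G a + integral {a..t} (\<lambda>t. f t * G t + F t * g t)" if t: "t \<in> {a..b}" for t
  proof -
    have sub: "{a..t} \<subseteq> {a..b}" using t by auto
    have ft: "f absolutely_integrable_on {a..t}" and gt: "g absolutely_integrable_on {a..t}"
      using f g sub by (auto intro: set_integrable_subset)
    have fi: "f integrable_on {a..t}" and gi: "g integrable_on {a..t}"
      using ft gt by (auto simp: absolutely_integrable_on_def)
    have i1: "(\<lambda>s. f s * integral {a..s} g) integrable_on {a..t}"
      using absolutely_integrable_mult_continuous[OF ft continuous_on_integral_absolutely_integrable[OF gt]]
      by (simp add: absolutely_integrable_on_def)
    have i2: "(\<lambda>s. integral {a..s} f * g s) integrable_on {a..t}"
      using absolutely_integrable_mult_continuous[OF gt continuous_on_integral_absolutely_integrable[OF ft]]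
      by (simp add: absolutely_integrable_on_def mult.commute)
    have "integral {a..t} (\<lambda>t. f t * G t + F t * g t) =
        integral {a..t} (\<lambda>s. (f s * G a + F a * g s) + (f s * integral {a..s} g + integral {a..s} f * g s))"
    proof (rule integral_cong)
      fix s assume "s \<in> {a..t}"
      then have "F s = F a + integral {a..s} f" "G s = G a + integral {a..s} g"
        using F G sub unfolding AC_with_def by blast+
      then show "f s * G s + F s * g s = (f s * G a + F a * g s) + (f s * integral {a..s} g + integral {a..s} f * g s)"
        by (simp only: algebra_simps)
    qed
    also have "\<dots> = (integral {a..t} f * G a + F a * integral {a..t} g) + integral {a..t} f * integral {a..t} g"
      using integral_by_parts_absolutely_integrable[OF ft gt] fi gi i1 i2
      by (simp add: Henstock_Kurzweil_Integration.integral_add integrable_add integrable_on_mult_left integrable_on_mult_right)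
    finally have eq: "integral {a..t} (\<lambda>t. f t * G t + F t * g t) = \<dots>" .
    have "F t = F a + integral {a..t} f" "G t = G a + integral {a..t} g"
      using F G t unfolding AC_with_def by blast+
    then show ?thesis unfolding eq by (simp only: algebra_simps)
  qed
  then show ?thesis using set_integral_add(1)[OF fG Fg] unfolding AC_with_def by blast
qed

lemma AC_with_C1:
  assumes "\<And>t. t \<in> {a..b} \<Longrightarrow> (F has_vector_derivative f t) (at t within {a..b})" "continuous_on {a..b} f"
  shows "AC_with a b F f"
  unfolding AC_with_def
proof (intro conjI ballI)
  show "f absolutely_integrable_on {a..b}" using assms(2) by (rule absolutely_integrable_continuous_real)
  fix t assume t: "t \<in> {a..b}"
  have "(f has_integral (F t - F a)) {a..t}"
  proof (rule fundamental_theorem_of_calculus)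
    fix s assume "s \<in> {a..t}"
    then show "(F has_vector_derivative f s) (at s within {a..t})"
      using t by (intro has_vector_derivative_within_subset[OF assms(1)]) auto
  qed (use t in auto)
  then show "F t = F a + integral {a..t} f" by (simp add: integral_unique)
qed

subsection \<open>Square-integrable functions\<close>

lemma L2_onI:
  assumes "(\<lambda>x. indicator S x *\<^sub>R f x) \<in> borel_measurable lebesgue"
    and "set_integrable lebesgue S h" "\<And>x. x \<in> S \<Longrightarrow> norm (f x)^2 \<le> h x"
  shows "L2_on S f"
  unfolding L2_on_def set_borel_measurable_def set_integrable_def
proof
  have eq: "(\<lambda>x. indicator S x *\<^sub>R (norm (f x))^2) = (\<lambda>x. norm (indicator S x *\<^sub>R f x)^2)"
    by (auto simp: indicator_def)
  show "integrable lebesgue (\<lambda>x. indicator S x *\<^sub>R (norm (f x))^2)"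
  proof (rule Bochner_Integration.integrable_bound[OF assms(2)[unfolded set_integrable_def]])
    show "(\<lambda>x. indicator S x *\<^sub>R (norm (f x))^2) \<in> borel_measurable lebesgue"
      unfolding eq using assms(1) by measurable
    show "AE x in lebesgue. norm (indicator S x *\<^sub>R (norm (f x))^2) \<le> norm (indicator S x *\<^sub>R h x)"
      using assms(3) by (auto simp: indicator_def intro!: AE_I2 order_trans[OF _ abs_ge_self])
  qed
qed (rule assms(1))

lemma L2_on_measurable: "L2_on S f \<Longrightarrow> (\<lambda>x. indicator S x *\<^sub>R f x) \<in> borel_measurable lebesgue"
  by (simp add: L2_on_def set_borel_measurable_def)

lemma L2_on_integrable: "L2_on S f \<Longrightarrow> set_integrable lebesgue S (\<lambda>x. norm (f x)^2)"
  by (simp add: L2_on_def)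

lemma L2_on_add:
  assumes "L2_on S f" "L2_on S g"
  shows "L2_on S (\<lambda>x. f x + g x)"
proof (rule L2_onI)
  show "(\<lambda>x. indicator S x *\<^sub>R (f x + g x)) \<in> borel_measurable lebesgue"
    using assms by (auto simp: scaleR_add_right intro!: borel_measurable_add L2_on_measurable)
  show "set_integrable lebesgue S (\<lambda>x. 2 * norm (f x)^2 + 2 * norm (g x)^2)"
    using assms by (auto intro!: set_integral_add simp: L2_on_integrable)
  show "norm (f x + g x)^2 \<le> 2 * norm (f x)^2 + 2 * norm (g x)^2" for x
  proof -
    have "norm (f x + g x)^2 \<le> (norm (f x) + norm (g x))^2"
      by (simp add: norm_triangle_ineq power_mono)
    also have "\<dots> \<le> 2 * norm (f x)^2 + 2 * norm (g x)^2"
      using sum_squares_bound[of "norm (f x)" "norm (g x)"] by (simp add: power2_sum)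
    finally show ?thesis .
  qed
qed

lemma L2_on_linear:
  fixes f :: "real \<Rightarrow> 'a::euclidean_space" and h :: "'a \<Rightarrow> 'b::euclidean_space"
  assumes "L2_on S f" and h: "linear h"
  shows "L2_on S (\<lambda>x. h (f x))"
proof -
  have bl: "bounded_linear h" using h by (simp add: linear_conv_bounded_linear)
  then obtain K where K: "\<And>x. norm (h x) \<le> norm x * K" "K > 0"
    using bounded_linear.pos_bounded by blast
  show ?thesis
  proof (rule L2_onI)
    have "(\<lambda>x. indicator S x *\<^sub>R h (f x)) = (\<lambda>x. h (indicator S x *\<^sub>R f x))"
      using h by (simp add: linear_scale)
    moreover have "(\<lambda>x. h (indicator S x *\<^sub>R f x)) \<in> borel_measurable lebesgue"
      by (rule measurable_compose[OF L2_on_measurable[OF assms(1)]])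
         (auto intro!: borel_measurable_continuous_onI linear_continuous_on bl)
    ultimately show "(\<lambda>x. indicator S x *\<^sub>R h (f x)) \<in> borel_measurable lebesgue" by simp
    show "set_integrable lebesgue S (\<lambda>x. K^2 * norm (f x)^2)"
      using assms(1) by (simp add: L2_on_integrable)
    show "norm (h (f x))^2 \<le> K^2 * norm (f x)^2" for x
      using power_mono[OF K(1)[of "f x"], of 2] by (simp add: power_mult_distrib mult.commute)
  qed
qed

lemma L2_on_sum:
  fixes f :: "'i \<Rightarrow> real \<Rightarrow> 'a::euclidean_space"
  assumes "finite A" "\<And>i. i \<in> A \<Longrightarrow> L2_on S (f i)"
  shows "L2_on S (\<lambda>x. \<Sum>i\<in>A. f i x)"
  using assms
proof (induction A)
  case empty
  show ?case by (simp add: L2_on_def set_borel_measurable_def set_integrable_def)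
next
  case (insert i A)
  then show ?case using L2_on_add[of S "f i"] by simp
qed

text \<open>Moves between the entrywise hypotheses and vector-valued functions; applied twice it
  also covers matrix-valued ones. The converse direction reassembles a vector as the sum of its axis
  components.\<close>

lemma L2_on_vec_iff:
  fixes f :: "real \<Rightarrow> 'a::euclidean_space^'n::finite"
  shows "L2_on S f \<longleftrightarrow> (\<forall>i. L2_on S (\<lambda>x. f x $ i))"
proof
  assume "L2_on S f"
  then show "\<forall>i. L2_on S (\<lambda>x. f x $ i)"
    by (intro allI L2_on_linear[where h="\<lambda>v. v $ _"] bounded_linear.linear[OF bounded_linear_vec_nth])
next
  assume *: "\<forall>i. L2_on S (\<lambda>x. f x $ i)"
  have "L2_on S (\<lambda>x. \<Sum>i\<in>UNIV. axis i (f x $ i))"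
  proof (rule L2_on_sum)
    fix i
    have "linear (axis i :: 'a \<Rightarrow> 'a^'n)"
      by (rule linearI) (auto simp: axis_def vec_eq_iff)
    then show "L2_on S (\<lambda>x. axis i (f x $ i))"
      using * L2_on_linear[of S "\<lambda>x. f x $ i" "axis i"] by auto
  qed simp
  moreover have "(\<Sum>i\<in>UNIV. axis i (f x $ i)) = f x" for x
    by (simp add: vec_eq_iff axis_def if_distrib cong: if_cong)
  ultimately show "L2_on S f" by simp
qed

text \<open>|f| |g| is dominated by |f|^2 + |g|^2. A general bilinear map is allowed so that real
  inner products, complex products, scalar multiplication and the matrix-vector product are all
  covered.\<close>

lemma L2_on_bilinear_integrable:
  fixes f :: "real \<Rightarrow> 'a::euclidean_space" and g :: "real \<Rightarrow> 'b::euclidean_space" and h :: "'a \<Rightarrow> 'b \<Rightarrow> 'c::euclidean_space"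
  assumes f: "L2_on S f" and g: "L2_on S g" and h: "bounded_bilinear h"
  shows "set_integrable lebesgue S (\<lambda>x. h (f x) (g x))"
  unfolding set_integrable_def
proof -
  obtain K where K: "\<And>x y. norm (h x y) \<le> norm x * norm y * K" "K > 0"
    using bounded_bilinear.pos_bounded[OF h] by blast
  have int: "set_integrable lebesgue S (\<lambda>x. K * (norm (f x)^2 + norm (g x)^2))"
    using f g by (auto intro!: set_integral_add simp: L2_on_integrable)
  show "integrable lebesgue (\<lambda>x. indicator S x *\<^sub>R h (f x) (g x))"
  proof (rule Bochner_Integration.integrable_bound[OF int[unfolded set_integrable_def]])
    have "(\<lambda>x. indicator S x *\<^sub>R h (f x) (g x)) = (\<lambda>x. h (indicator S x *\<^sub>R f x) (indicator S x *\<^sub>R g x))"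
      by (auto simp: indicator_def bounded_bilinear.zero_left[OF h])
    moreover have "(\<lambda>x. h (indicator S x *\<^sub>R f x) (indicator S x *\<^sub>R g x)) \<in> borel_measurable lebesgue"
      by (rule borel_measurable_continuous_Pair[OF L2_on_measurable[OF f] L2_on_measurable[OF g]])
         (intro bounded_bilinear.continuous_on[OF h] continuous_intros)
    ultimately show "(\<lambda>x. indicator S x *\<^sub>R h (f x) (g x)) \<in> borel_measurable lebesgue" by simp
    have "norm (h (f x) (g x)) \<le> K * (norm (f x)^2 + norm (g x)^2)" for x
    proof -
      have "norm (f x) * norm (g x) \<le> norm (f x)^2 + norm (g x)^2"
        using sum_squares_bound[of "norm (f x)" "norm (g x)"] mult_nonneg_nonneg[OF norm_ge_zero norm_ge_zero, of "f x" "g x"]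
        by linarith
      then have "norm (f x) * norm (g x) * K \<le> (norm (f x)^2 + norm (g x)^2) * K"
        using K(2) by simp
      then show ?thesis using K(1)[of "f x" "g x"] by (simp add: mult.commute)
    qed
    then show "AE x in lebesgue. norm (indicator S x *\<^sub>R h (f x) (g x)) \<le> norm (indicator S x *\<^sub>R (K * (norm (f x)^2 + norm (g x)^2)))"
      by (auto simp: indicator_def intro!: AE_I2 order_trans[OF _ abs_ge_self])
  qed
qed

lemma L2_on_continuous:
  assumes "continuous_on {a..b} f"
  shows "L2_on {a..b} f"
proof (rule L2_onI)
  have "f absolutely_integrable_on {a..b}" using assms by (rule absolutely_integrable_continuous_real)
  then show "(\<lambda>x. indicat_real {a..b} x *\<^sub>R f x) \<in> borel_measurable lebesgue"
    by (simp add: set_integrable_def)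
  show "set_integrable lebesgue {a..b} (\<lambda>x. norm (f x)^2)"
    using assms by (intro absolutely_integrable_continuous_real continuous_intros)
qed simp

lemma L2_on_absolutely_integrable:
  fixes f :: "real \<Rightarrow> 'a::euclidean_space"
  assumes "L2_on {a..b} f"
  shows "f absolutely_integrable_on {a..b}"
  using L2_on_bilinear_integrable[OF L2_on_continuous[of a b "\<lambda>x. 1::real"] assms bounded_bilinear_scaleR]
  by simp

subsection \<open>The space M2\<close>

lemma cvscale_nth [simp]: "cvscale c v $ i = c * v $ i"
  by (simp add: cvscale_def)

lemma linear_cvscale: "linear (cvscale c)"
  by (rule linearI) (auto simp: vec_eq_iff algebra_simps)

lemma norm_cvscale [simp]: "norm (cvscale c v) = cmod c * norm v"
proof -
  have "norm (cvscale c v) = L2_set (\<lambda>i. cmod c * norm (v $ i)) UNIV"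
    by (simp add: norm_vec_def norm_mult)
  also have "\<dots> = cmod c * norm v"
    by (simp add: L2_set_right_distrib norm_vec_def)
  finally show ?thesis .
qed

lemma cvscale_of_real: "cvscale (complex_of_real r) v = r *\<^sub>R v"
  by (simp add: vec_eq_iff scaleR_conv_of_real[where 'a=complex])

lemma cvscale_zero [simp]: "cvscale 0 v = 0" and cvscale_one [simp]: "cvscale 1 v = v" and cvscale_minus_one [simp]: "cvscale (-1) v = - v"
  by (auto simp: vec_eq_iff)

lemma in_M2_add: "in_M2 x \<Longrightarrow> in_M2 x' \<Longrightarrow> in_M2 (m2_add x x')"
  by (simp add: in_M2_def m2_add_def L2_on_add)

lemma in_M2_scale: "in_M2 x \<Longrightarrow> in_M2 (m2_scale c x)"
  by (simp add: in_M2_def m2_scale_def L2_on_linear linear_cvscale)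

lemma m2_diff_conv: "m2_diff x x' = m2_add (m2_scale 1 x) (m2_scale (-1) x')"
  by (simp add: m2_diff_def m2_add_def m2_scale_def)

lemma in_M2_diff: "in_M2 x \<Longrightarrow> in_M2 x' \<Longrightarrow> in_M2 (m2_diff x x')"
  by (simp add: m2_diff_conv in_M2_add in_M2_scale)

lemma m2_equiv_refl [simp]: "m2_equiv x x"
  by (simp add: m2_equiv_def)

lemma m2_equiv_sym: "m2_equiv x y \<Longrightarrow> m2_equiv y x"
  unfolding m2_equiv_def by (auto elim: eventually_mono)

lemma m2_equiv_trans: "m2_equiv x y \<Longrightarrow> m2_equiv y z \<Longrightarrow> m2_equiv x z"
  unfolding m2_equiv_def by (auto elim: eventually_elim2)

lemma m2_equiv_scale: "m2_equiv x y \<Longrightarrow> m2_equiv (m2_scale c x) (m2_scale c y)"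
  unfolding m2_equiv_def m2_scale_def by (auto elim: eventually_mono)

lemma m2_equiv_diff: "m2_equiv x y \<Longrightarrow> m2_equiv x' y' \<Longrightarrow> m2_equiv (m2_diff x x') (m2_diff y y')"
  unfolding m2_equiv_def m2_diff_def by (auto elim: eventually_elim2)

text \<open>The real part of \<open>m2_inner\<close>. Being a symmetric real bilinear form, it
  carries the Cauchy-Schwarz and triangle inequalities without conjugations; the complex pairing is
  recovered from its values at z and \<i>z.\<close>

definition m2_rinner :: "'n::finite m2 \<Rightarrow> 'n m2 \<Rightarrow> real" where
  "m2_rinner x x' = fst x \<bullet> fst x' + (LINT \<theta>:{-1..0}|lebesgue. snd x \<theta> \<bullet> snd x' \<theta>)"

lemma in_M2_inner_integrable:
  assumes "in_M2 x" "in_M2 x'"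
  shows "set_integrable lebesgue {-1..0} (\<lambda>\<theta>. snd x \<theta> \<bullet> snd x' \<theta>)"
  using assms unfolding in_M2_def by (intro L2_on_bilinear_integrable bounded_bilinear_inner)

lemma m2_rinner_commute: "m2_rinner x x' = m2_rinner x' x"
  by (simp add: m2_rinner_def inner_commute)

lemma m2_rinner_add_left:
  assumes "in_M2 x" "in_M2 y" "in_M2 z"
  shows "m2_rinner (m2_add x y) z = m2_rinner x z + m2_rinner y z"
  using set_integral_add(2)[OF in_M2_inner_integrable[OF assms(1,3)] in_M2_inner_integrable[OF assms(2,3)]]
  by (simp add: m2_rinner_def m2_add_def inner_add_left)

lemma m2_rinner_add_right:
  assumes "in_M2 x" "in_M2 y" "in_M2 z"
  shows "m2_rinner z (m2_add x y) = m2_rinner z x + m2_rinner z y"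
  using m2_rinner_add_left[OF assms] by (simp add: m2_rinner_commute)

lemma m2_rinner_scale_left: "m2_rinner (m2_scale (complex_of_real r) x) z = r * m2_rinner x z"
  by (simp add: m2_rinner_def m2_scale_def cvscale_of_real distrib_left)

lemma m2_rinner_scale_right: "m2_rinner z (m2_scale (complex_of_real r) x) = r * m2_rinner z x"
  by (simp add: m2_rinner_commute[of z] m2_rinner_scale_left)

lemma m2_rinner_self: "m2_rinner x x = (m2_norm x)^2"
proof -
  have "0 \<le> (LINT \<theta>:{-1..0}|lebesgue. (norm (snd x \<theta>))^2)"
    unfolding set_lebesgue_integral_def by (rule integral_nonneg_AE) auto
  then show ?thesis
    by (simp add: m2_rinner_def m2_norm_def power2_norm_eq_inner[symmetric])
qed

lemma m2_norm_nonneg [simp]: "0 \<le> m2_norm x"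
proof -
  have "0 \<le> (LINT \<theta>:{-1..0}|lebesgue. (norm (snd x \<theta>))^2)"
    unfolding set_lebesgue_integral_def by (rule integral_nonneg_AE) auto
  then show ?thesis by (simp add: m2_norm_def)
qed

lemma m2_norm_scale: "m2_norm (m2_scale c x) = cmod c * m2_norm x"
proof -
  have "m2_norm (m2_scale c x) = sqrt (cmod c ^2 * ((norm (fst x))^2 + (LINT \<theta>:{-1..0}|lebesgue. (norm (snd x \<theta>))^2)))"
    by (simp add: m2_norm_def m2_scale_def power_mult_distrib distrib_left)
  then show ?thesis by (simp add: real_sqrt_mult m2_norm_def)
qed

text \<open>The squared norm of x + t y is a nonnegative quadratic polynomial in t. The degenerate
  leading coefficient is treated separately.\<close>

lemma m2_rinner_le:
  assumes x: "in_M2 x" and y: "in_M2 y"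
  shows "m2_rinner x y \<le> m2_norm x * m2_norm y"
proof -
  define a b c where "a = m2_norm x" and "b = m2_norm y" and "c = m2_rinner x y"
  have q: "0 \<le> a^2 + 2 * t * c + t^2 * b^2" for t
  proof -
    let ?z = "m2_scale (complex_of_real t) y"
    have z: "in_M2 ?z" using y by (rule in_M2_scale)
    have "0 \<le> m2_rinner (m2_add x ?z) (m2_add x ?z)" by (simp add: m2_rinner_self)
    also have "\<dots> = a^2 + 2 * t * c + t^2 * b^2"
      using x y z unfolding a_def b_def c_def
      by (simp flip: m2_rinner_self add: m2_rinner_add_left m2_rinner_add_right in_M2_add m2_rinner_scale_left
          m2_rinner_scale_right m2_rinner_commute[of y x]) (simp add: algebra_simps power2_eq_square)
    finally show ?thesis .
  qed
  have ab: "a \<ge> 0" "b \<ge> 0" by (auto simp: a_def b_def)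
  show ?thesis
  proof (cases "b = 0")
    case True
    have "c \<le> 0"
    proof (rule ccontr)
      assume "\<not> c \<le> 0"
      \<comment> \<open>For b = 0 the polynomial is a^2 + 2 t c; this t gives it the value
        -1.\<close>
      then have "2 * (- (a^2 + 1) / (2 * c)) * c = - (a^2 + 1)" by simp
      then show False using q[of "- (a^2 + 1) / (2 * c)"] True by simp
    qed
    then show ?thesis using True by (simp add: b_def c_def)
  next
    case False
    then have b: "b > 0" using ab by simp
    \<comment> \<open>The minimising value of t.\<close>
    have "0 \<le> a^2 + 2 * (- c / b^2) * c + (- c / b^2)^2 * b^2" by (rule q)
    also have "\<dots> = a^2 - c^2 / b^2" using b by (simp add: field_simps power2_eq_square)
    finally have "c^2 \<le> (a * b)^2" using b by (simp add: field_simps power_mult_distrib)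
    then have "c \<le> a * b" by (rule power2_le_imp_le) (use ab in simp)
    then show ?thesis by (simp add: a_def b_def c_def)
  qed
qed

lemma m2_norm_add_le:
  assumes x: "in_M2 x" and y: "in_M2 y"
  shows "m2_norm (m2_add x y) \<le> m2_norm x + m2_norm y"
proof (rule power2_le_imp_le)
  have "(m2_norm (m2_add x y))^2 = (m2_norm x)^2 + 2 * m2_rinner x y + (m2_norm y)^2"
    using x y by (simp flip: m2_rinner_self
        add: m2_rinner_add_left m2_rinner_add_right in_M2_add m2_rinner_commute[of y x])
  also have "\<dots> \<le> (m2_norm x + m2_norm y)^2"
    using m2_rinner_le[OF x y] by (simp add: power2_sum)
  finally show "(m2_norm (m2_add x y))^2 \<le> (m2_norm x + m2_norm y)^2" .
qed simp

section \<open>The complex pairing on M2 and its continuity\<close>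

lemma in_M2_sum_integrable:
  assumes "in_M2 x" "in_M2 x'"
  shows "set_integrable lebesgue {-1..0} (\<lambda>\<theta>. \<Sum>i\<in>UNIV. snd x \<theta> $ i * cnj (snd x' \<theta> $ i))"
proof -
  have "set_integrable lebesgue {-1..0} (\<lambda>\<theta>. snd x \<theta> $ i * cnj (snd x' \<theta> $ i))" for i
  proof (rule L2_on_bilinear_integrable[OF _ _ bounded_bilinear_mult])
    have "L2_on {-1..0} (\<lambda>\<theta>. snd x \<theta> $ i)" "L2_on {-1..0} (\<lambda>\<theta>. snd x' \<theta> $ i)"
      using assms unfolding in_M2_def L2_on_vec_iff by auto
    then show "L2_on {-1..0} (\<lambda>\<theta>. snd x \<theta> $ i)" "L2_on {-1..0} (\<lambda>\<theta>. cnj (snd x' \<theta> $ i))"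
      by (auto intro: L2_on_linear[where h=cnj] bounded_linear.linear[OF bounded_linear_cnj])
  qed
  then show ?thesis unfolding set_integrable_def scaleR_sum_right
    by (intro Bochner_Integration.integrable_sum)
qed

lemma m2_inner_add_left:
  assumes "in_M2 x" "in_M2 y" "in_M2 z"
  shows "m2_inner (m2_add x y) z = m2_inner x z + m2_inner y z"
  using set_integral_add(2)[OF in_M2_sum_integrable[OF assms(1,3)] in_M2_sum_integrable[OF assms(2,3)]]
  by (simp add: m2_inner_def m2_add_def distrib_right sum.distrib)

lemma m2_inner_scale_left: "m2_inner (m2_scale c x) z = c * m2_inner x z"
  by (simp add: m2_inner_def m2_scale_def distrib_left mult.assoc flip: sum_distrib_left)

lemma m2_inner_diff_left:
  assumes "in_M2 x" "in_M2 y" "in_M2 z"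
  shows "m2_inner (m2_diff x y) z = m2_inner x z - m2_inner y z"
  using assms by (simp add: m2_diff_conv m2_inner_add_left in_M2_scale m2_inner_scale_left)

text \<open>The imaginary part is again a real inner product, because Re (v cnj (\<i> w)) = Im (v
  cnj w).\<close>

lemma sum_mult_cnj_eq_inner:
  fixes v w :: "complex^'n::finite"
  shows "(\<Sum>i\<in>UNIV. v $ i * cnj (w $ i)) = Complex (v \<bullet> w) (v \<bullet> cvscale \<i> w)"
  by (simp add: complex_eq_iff inner_vec_def inner_complex_def sum_subtractf algebra_simps)

lemma m2_inner_eq_Complex:
  assumes "in_M2 x" "in_M2 z"
  shows "m2_inner x z = Complex (m2_rinner x z) (m2_rinner x (m2_scale \<i> z))"
proof -
  note int = in_M2_sum_integrable[OF assms]
  have "Re (LINT \<theta>:{-1..0}|lebesgue. (\<Sum>i\<in>UNIV. snd x \<theta> $ i * cnj (snd z \<theta> $ i)))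
      = (LINT \<theta>:{-1..0}|lebesgue. snd x \<theta> \<bullet> snd z \<theta>)"
    "Im (LINT \<theta>:{-1..0}|lebesgue. (\<Sum>i\<in>UNIV. snd x \<theta> $ i * cnj (snd z \<theta> $ i)))
      = (LINT \<theta>:{-1..0}|lebesgue. snd x \<theta> \<bullet> cvscale \<i> (snd z \<theta>))"
    using int unfolding set_integrable_def set_lebesgue_integral_def
    by (simp_all flip: integral_Re integral_Im add: sum_mult_cnj_eq_inner)
  then show ?thesis
    by (simp add: complex_eq_iff m2_inner_def m2_rinner_def m2_scale_def sum_mult_cnj_eq_inner)
qed

text \<open>The factor 2 comes from estimating real and imaginary part separately; only boundedness
  in x matters later.\<close>

lemma m2_inner_bound:
  assumes "in_M2 x" "in_M2 z"
  shows "cmod (m2_inner x z) \<le> 2 * m2_norm z * m2_norm x"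
proof -
  have *: "\<bar>m2_rinner x w\<bar> \<le> m2_norm w * m2_norm x" if w: "in_M2 w" for w
  proof -
    have "m2_rinner x (m2_scale (complex_of_real (-1)) w) \<le> m2_norm x * m2_norm (m2_scale (complex_of_real (-1)) w)"
      using m2_rinner_le[OF assms(1) in_M2_scale[OF w]] .
    then show ?thesis using m2_rinner_le[OF assms(1) w]
      unfolding m2_rinner_scale_right m2_norm_scale by (simp add: mult.commute)
  qed
  have "cmod (m2_inner x z) \<le> \<bar>Re (m2_inner x z)\<bar> + \<bar>Im (m2_inner x z)\<bar>" by (rule cmod_le)
  also have "\<dots> \<le> 2 * m2_norm z * m2_norm x"
    using *[OF assms(2)] *[OF in_M2_scale[OF assms(2), of \<i>]]
    by (simp add: m2_inner_eq_Complex[OF assms] m2_norm_scale)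
  finally show ?thesis .
qed

lemma m2_norm_cong:
  assumes "in_M2 x" "in_M2 y" "m2_equiv x y"
  shows "m2_norm x = m2_norm y"
proof -
  have "(LINT \<theta>:{-1..0}|lebesgue. (norm (snd x \<theta>))^2) = (LINT \<theta>:{-1..0}|lebesgue. (norm (snd y \<theta>))^2)"
    unfolding set_lebesgue_integral_def
    using assms L2_on_integrable[of "{-1..0}" "snd x"] L2_on_integrable[of "{-1..0}" "snd y"]
    unfolding in_M2_def m2_equiv_def set_integrable_def
    by (intro integral_cong_AE) (auto elim!: eventually_mono simp: indicator_def)
  then show ?thesis using assms(3) by (simp add: m2_norm_def m2_equiv_def)
qed

lemma m2_inner_cong:
  assumes "in_M2 x" "in_M2 y" "in_M2 z" "m2_equiv x y"
  shows "m2_inner x z = m2_inner y z"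
proof -
  have "(LINT \<theta>:{-1..0}|lebesgue. (\<Sum>i\<in>UNIV. snd x \<theta> $ i * cnj (snd z \<theta> $ i)))
    = (LINT \<theta>:{-1..0}|lebesgue. (\<Sum>i\<in>UNIV. snd y \<theta> $ i * cnj (snd z \<theta> $ i)))"
    unfolding set_lebesgue_integral_def
    using assms(4) in_M2_sum_integrable[OF assms(1,3)] in_M2_sum_integrable[OF assms(2,3)]
    unfolding m2_equiv_def set_integrable_def
    by (intro integral_cong_AE) (auto elim!: eventually_mono simp: indicator_def)
  then show ?thesis using assms(4) by (simp add: m2_inner_def m2_equiv_def)
qed

subsection \<open>Completeness and uniform boundedness\<close>

lemma norm_fst_le_m2_norm: "norm (fst x) \<le> m2_norm x"
proof -
  have "0 \<le> (LINT \<theta>:{-1..0}|lebesgue. (norm (snd x \<theta>))^2)"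
    unfolding set_lebesgue_integral_def by (rule integral_nonneg_AE) auto
  then show ?thesis unfolding m2_norm_def by (intro real_le_rsqrt) simp
qed

lemma integral_snd_le_m2_norm: "(LINT \<theta>:{-1..0}|lebesgue. (norm (snd x \<theta>))^2) \<le> (m2_norm x)^2"
  by (simp add: power2_norm_eq_inner flip: m2_rinner_self) (simp add: m2_rinner_def)

lemma nn_integral_norm_power2:
  assumes "L2_on S f"
  shows "(\<integral>\<^sup>+\<theta>. ennreal (norm (indicator S \<theta> *\<^sub>R f \<theta>)^2) \<partial>lebesgue)
    = ennreal (LINT \<theta>:S|lebesgue. (norm (f \<theta>))^2)"
proof -
  have eq: "norm (indicator S \<theta> *\<^sub>R f \<theta>)^2 = indicator S \<theta> *\<^sub>R (norm (f \<theta>))^2" for \<theta>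
    by (auto simp: indicator_def)
  show ?thesis
    using L2_on_integrable[OF assms] unfolding set_integrable_def set_lebesgue_integral_def eq
    by (intro nn_integral_eq_integral) auto
qed

text \<open>The L1 norm is bounded by the L2 norm on an interval of length 1. Pointwise s \<le> e/2
  + s^2/(2e), and each summand integrates to at most e/2. In the completeness proof this makes the
  increments summable in L1 and hence almost everywhere.\<close>

lemma nn_integral_norm_le:
  assumes x: "in_M2 x" and e: "m2_norm x \<le> e" "e > 0"
  shows "(\<integral>\<^sup>+\<theta>. ennreal (norm (indicator {-1..0} \<theta> *\<^sub>R snd x \<theta>)) \<partial>lebesgue) \<le> ennreal e"
proof -
  let ?I = "{-1..0::real}"
  have int: "set_integrable lebesgue ?I (\<lambda>\<theta>. norm (snd x \<theta>)^2)"
    using x unfolding in_M2_def by (rule L2_on_integrable)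
  have int1: "set_integrable lebesgue ?I (\<lambda>\<theta>. e / 2)"
    by (intro absolutely_integrable_continuous_real continuous_intros)
  have int2: "set_integrable lebesgue ?I (\<lambda>\<theta>. e / 2 + inverse (2 * e) * norm (snd x \<theta>)^2)"
    by (intro set_integral_add int1 set_integrable_mult_right int)
  have "(\<integral>\<^sup>+\<theta>. ennreal (norm (indicator ?I \<theta> *\<^sub>R snd x \<theta>)) \<partial>lebesgue)
     \<le> (\<integral>\<^sup>+\<theta>. ennreal (indicator ?I \<theta> *\<^sub>R (e / 2 + inverse (2 * e) * norm (snd x \<theta>)^2)) \<partial>lebesgue)"
  proof (intro nn_integral_mono ennreal_leI)
    fix \<theta>
    have "norm (snd x \<theta>) \<le> e / 2 + inverse (2 * e) * norm (snd x \<theta>)^2"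
      using e(2) sum_squares_bound[of e "norm (snd x \<theta>)"] by (simp add: field_simps power2_eq_square)
    then show "norm (indicat_real ?I \<theta> *\<^sub>R snd x \<theta>) \<le> indicat_real ?I \<theta> *\<^sub>R (e / 2 + inverse (2 * e) * norm (snd x \<theta>)^2)"
      by (simp add: indicator_def)
  qed
  also have "\<dots> = ennreal (LINT \<theta>:?I|lebesgue. e / 2 + inverse (2 * e) * norm (snd x \<theta>)^2)"
    using int2 e(2) unfolding set_integrable_def set_lebesgue_integral_def
    by (intro nn_integral_eq_integral) auto
  also have "(LINT \<theta>:?I|lebesgue. e / 2 + inverse (2 * e) * norm (snd x \<theta>)^2)
     = (LINT \<theta>:?I|lebesgue. e / 2) + (LINT \<theta>:?I|lebesgue. inverse (2 * e) * norm (snd x \<theta>)^2)"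
    by (intro set_integral_add int1 set_integrable_mult_right int)
  also have "(LINT \<theta>:?I|lebesgue. e / 2) = e / 2"
    unfolding set_lebesgue_integral_eq_integral(2)[OF int1] by simp
  also have "(LINT \<theta>:?I|lebesgue. inverse (2 * e) * norm (snd x \<theta>)^2) \<le> inverse (2 * e) * e^2"
  proof -
    have "(LINT \<theta>:?I|lebesgue. norm (snd x \<theta>)^2) \<le> e^2"
      using integral_snd_le_m2_norm[of x] power_mono[OF e(1), of 2] by simp
    then show ?thesis using e(2) unfolding set_integral_mult_right by (intro mult_left_mono) auto
  qed
  also have "e / 2 + inverse (2 * e) * e^2 = e"
    using e(2) by (simp add: field_simps power2_eq_square)
  finally show ?thesis by (simp add: ennreal_leI)
qed

text \<open>The Riesz-Fischer argument for a sequence with increments of size 8^{-n}: the second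
  components converge almost everywhere by absolute summability, and Fatou supplies the L2 estimate.
  The explicit rate is kept because the gliding hump argument compares 2/7 with 1/2.\<close>

lemma m2_complete_geometric:
  fixes x :: "nat \<Rightarrow> 'n::finite m2"
  assumes x: "\<And>n. in_M2 (x n)" and step: "\<And>n. m2_norm (m2_diff (x (Suc n)) (x n)) \<le> (1/8)^Suc n"
  shows "\<exists>y. in_M2 y \<and> (\<forall>n. m2_norm (m2_diff y (x n)) \<le> 2/7 * (1/8)^n)"
proof -
  let ?I = "{-1..0::real}"
  \<comment> \<open>The bound is the finite geometric sum of 8^{-j} over n < j \<le> n + k.\<close>
  have dist: "m2_norm (m2_diff (x (n + k)) (x n)) \<le> (1/8)^n / 7 * (1 - (1/8)^k)" for n k
  proof (induction k)
    case 0
    have "m2_norm (m2_diff (x n) (x n)) = 0" by (simp add: m2_norm_def m2_diff_def)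
    then show ?case by simp
  next
    case (Suc k)
    have "m2_diff (x (n + Suc k)) (x n) = m2_add (m2_diff (x (Suc (n + k))) (x (n + k))) (m2_diff (x (n + k)) (x n))"
      by (simp add: m2_diff_def m2_add_def)
    then have "m2_norm (m2_diff (x (n + Suc k)) (x n)) \<le>
       m2_norm (m2_diff (x (Suc (n + k))) (x (n + k))) + m2_norm (m2_diff (x (n + k)) (x n))"
      using m2_norm_add_le[OF in_M2_diff[OF x x] in_M2_diff[OF x x]] by metis
    also have "\<dots> \<le> (1/8)^Suc (n + k) + (1/8)^n / 7 * (1 - (1/8)^k)"
      by (intro add_mono step Suc.IH)
    also have "\<dots> = (1/8)^n / 7 * (1 - (1/8)^Suc k)" by (simp add: power_add field_simps)
    finally show ?case .
  qed
  have dist': "m2_norm (m2_diff (x k) (x n)) \<le> (1/8)^n / 7" if "n \<le> k" for n k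
  proof -
    have "m2_norm (m2_diff (x (n + (k - n))) (x n)) \<le> (1/8)^n / 7 * (1 - (1/8)^(k-n))" by (rule dist)
    also have "\<dots> \<le> (1/8)^n / 7 * 1" by (intro mult_left_mono) auto
    finally show ?thesis using that by simp
  qed
  have "summable (\<lambda>n. fst (x (Suc n)) - fst (x n))"
  proof (rule summable_comparison_test)
    show "\<exists>N. \<forall>n\<ge>N. norm (fst (x (Suc n)) - fst (x n)) \<le> (1/8)^n"
    proof (intro exI allI impI)
      fix n :: nat
      have "norm (fst (x (Suc n)) - fst (x n)) \<le> m2_norm (m2_diff (x (Suc n)) (x n))"
        using norm_fst_le_m2_norm[of "m2_diff (x (Suc n)) (x n)"] by (simp add: m2_diff_def)
      also have "\<dots> \<le> (1/8)^Suc n" by (rule step)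
      finally show "norm (fst (x (Suc n)) - fst (x n)) \<le> (1/8)^n"
        by (rule order_trans) (simp add: field_simps)
    qed
    show "summable (\<lambda>n. (1/8::real)^n)" by (rule summable_geometric) simp
  qed
  then obtain l where "(\<lambda>n. \<Sum>i<n. fst (x (Suc i)) - fst (x i)) \<longlonglongrightarrow> l"
    unfolding summable_def sums_def by blast
  then have "(\<lambda>n. (fst (x n) - fst (x 0)) + fst (x 0)) \<longlonglongrightarrow> l + fst (x 0)"
    by (intro tendsto_add tendsto_const) (simp add: sum_lessThan_telescope[of "\<lambda>n. fst (x n)"])
  then obtain y1 where y1: "(\<lambda>n. fst (x n)) \<longlonglongrightarrow> y1" by auto
  define X where "X n \<theta> = indicat_real ?I \<theta> *\<^sub>R snd (x n) \<theta>" for n \<theta>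
  have Xm [measurable]: "X n \<in> borel_measurable lebesgue" for n
    using L2_on_measurable[of ?I "snd (x n)"] x[of n] unfolding X_def[abs_def] in_M2_def by simp
  \<comment> \<open>Where the sequence diverges, \<open>lim\<close> still gives some value, and the
    resulting function is measurable; the divergence set will be null.\<close>
  define y2 where "y2 \<theta> = lim (\<lambda>n. X n \<theta>)" for \<theta>
  have y2m [measurable]: "y2 \<in> borel_measurable lebesgue"
    unfolding y2_def[abs_def] by (rule borel_measurable_lim_metric) simp
  have sub: "(\<integral>\<^sup>+\<theta>. ennreal (norm (X (Suc n) \<theta> - X n \<theta>)) \<partial>lebesgue) \<le> ennreal ((1/8)^n)" for n
  proof -
    have "m2_norm (m2_diff (x (Suc n)) (x n)) \<le> (1/8)^n"
      using step[of n] by (rule order_trans) (simp add: field_simps)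
    from nn_integral_norm_le[OF in_M2_diff[OF x x] this] show ?thesis
      by (simp add: X_def m2_diff_def scaleR_diff_right)
  qed
  have "(\<integral>\<^sup>+\<theta>. (\<Sum>n. ennreal (norm (X (Suc n) \<theta> - X n \<theta>))) \<partial>lebesgue)
      = (\<Sum>n. \<integral>\<^sup>+\<theta>. ennreal (norm (X (Suc n) \<theta> - X n \<theta>)) \<partial>lebesgue)"
    by (rule nn_integral_suminf) measurable
  also have "\<dots> \<le> (\<Sum>n. ennreal ((1/8)^n))" by (intro suminf_le sub) auto
  also have "\<dots> = ennreal (\<Sum>n. (1/8)^n)" by (intro suminf_ennreal2 summable_geometric) auto
  finally have "(\<integral>\<^sup>+\<theta>. (\<Sum>n. ennreal (norm (X (Suc n) \<theta> - X n \<theta>))) \<partial>lebesgue) \<noteq> \<infinity>"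
    using le_less_trans[OF _ ennreal_less_top] by fastforce
  then have "AE \<theta> in lebesgue. (\<Sum>n. ennreal (norm (X (Suc n) \<theta> - X n \<theta>))) \<noteq> \<infinity>"
    by (intro nn_integral_PInf_AE) measurable
  then have conv: "AE \<theta> in lebesgue. (\<lambda>n. X n \<theta>) \<longlonglongrightarrow> y2 \<theta>"
  proof eventually_elim
    case (elim \<theta>)
    then have "summable (\<lambda>n. norm (X (Suc n) \<theta> - X n \<theta>))"
      by (intro summable_suminf_not_top) auto
    then have "summable (\<lambda>n. X (Suc n) \<theta> - X n \<theta>)" by (rule summable_norm_cancel)
    then obtain l where "(\<lambda>n. \<Sum>i<n. X (Suc i) \<theta> - X i \<theta>) \<longlonglongrightarrow> l"
      unfolding summable_def sums_def by blast
    then have "(\<lambda>n. (X n \<theta> - X 0 \<theta>) + X 0 \<theta>) \<longlonglongrightarrow> l + X 0 \<theta>"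
      by (intro tendsto_add tendsto_const) (simp add: sum_lessThan_telescope[of "\<lambda>n. X n \<theta>"])
    then have "(\<lambda>n. X n \<theta>) \<longlonglongrightarrow> l + X 0 \<theta>" by simp
    then show ?case unfolding y2_def by (simp add: limI)
  qed
  \<comment> \<open>Fatou in k with m fixed turns the Cauchy estimate into an estimate for the
    limit. Finiteness of this integral is also what places y in M2.\<close>
  have fatou: "(\<integral>\<^sup>+\<theta>. ennreal (norm (y2 \<theta> - X m \<theta>)^2) \<partial>lebesgue) \<le> ennreal (((1/8)^m / 7)^2)" for m
  proof -
    have "(\<integral>\<^sup>+\<theta>. ennreal (norm (y2 \<theta> - X m \<theta>)^2) \<partial>lebesgue)
       = (\<integral>\<^sup>+\<theta>. liminf (\<lambda>k. ennreal (norm (X k \<theta> - X m \<theta>)^2)) \<partial>lebesgue)"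
    proof (rule nn_integral_cong_AE)
      show "AE \<theta> in lebesgue. ennreal (norm (y2 \<theta> - X m \<theta>)^2) = liminf (\<lambda>k. ennreal (norm (X k \<theta> - X m \<theta>)^2))"
        using conv
      proof eventually_elim
        case (elim \<theta>)
        then have "(\<lambda>k. ennreal (norm (X k \<theta> - X m \<theta>)^2)) \<longlonglongrightarrow> ennreal (norm (y2 \<theta> - X m \<theta>)^2)"
          by (intro tendsto_intros)
        then show ?case by (rule lim_imp_Liminf[OF trivial_limit_sequentially, symmetric])
      qed
    qed
    also have "\<dots> \<le> liminf (\<lambda>k. \<integral>\<^sup>+\<theta>. ennreal (norm (X k \<theta> - X m \<theta>)^2) \<partial>lebesgue)"
      by (rule nn_integral_liminf) measurable
    also have "\<dots> \<le> ennreal (((1/8)^m / 7)^2)"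
    proof (rule Liminf_le)
      show "\<forall>\<^sub>F k in sequentially. (\<integral>\<^sup>+\<theta>. ennreal (norm (X k \<theta> - X m \<theta>)^2) \<partial>lebesgue) \<le> ennreal (((1/8)^m / 7)^2)"
        using eventually_ge_at_top[of m]
      proof eventually_elim
        case (elim k)
        have L: "L2_on ?I (snd (m2_diff (x k) (x m)))"
          using in_M2_diff[OF x x] by (simp add: in_M2_def)
        have "(\<integral>\<^sup>+\<theta>. ennreal (norm (X k \<theta> - X m \<theta>)^2) \<partial>lebesgue) =
           ennreal (LINT \<theta>:?I|lebesgue. (norm (snd (m2_diff (x k) (x m)) \<theta>))^2)"
          unfolding nn_integral_norm_power2[OF L, symmetric] by (simp add: X_def m2_diff_def scaleR_diff_right)
        also have "\<dots> \<le> ennreal ((m2_norm (m2_diff (x k) (x m)))^2)"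
          by (intro ennreal_leI integral_snd_le_m2_norm)
        also have "\<dots> \<le> ennreal (((1/8)^m / 7)^2)"
          by (intro ennreal_leI power_mono dist' elim) simp
        finally show ?case .
      qed
    qed simp
    finally show ?thesis .
  qed
  have y2out: "y2 \<theta> = 0" if "\<theta> \<notin> ?I" for \<theta>
    using that unfolding y2_def X_def by (simp add: lim_const)
  have ind: "indicator ?I \<theta> *\<^sub>R (y2 \<theta> - snd (x m) \<theta>) = y2 \<theta> - X m \<theta>" for m \<theta>
    using y2out[of \<theta>] by (auto simp: X_def indicator_def)
  have ind2: "indicator ?I \<theta> *\<^sub>R (norm (y2 \<theta> - snd (x m) \<theta>))^2 = (norm (y2 \<theta> - X m \<theta>))^2" for m \<theta>
    unfolding ind[symmetric] by (auto simp: indicator_def)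
  have L2d: "L2_on ?I (\<lambda>\<theta>. y2 \<theta> - snd (x m) \<theta>)" for m
    unfolding L2_on_def set_borel_measurable_def set_integrable_def ind ind2
  proof
    show "integrable lebesgue (\<lambda>\<theta>. (norm (y2 \<theta> - X m \<theta>))^2)"
      using fatou[of m] by (intro integrableI_nonneg) (auto intro: le_less_trans ennreal_less_top)
  qed measurable
  define y where "y = (y1, y2)"
  have "in_M2 y"
  proof -
    have "L2_on ?I (\<lambda>\<theta>. (y2 \<theta> - snd (x 0) \<theta>) + snd (x 0) \<theta>)"
      using L2_on_add[OF L2d] x[of 0] unfolding in_M2_def by blast
    then show ?thesis by (simp add: in_M2_def y_def)
  qed
  moreover have "m2_norm (m2_diff y (x m)) \<le> 2/7 * (1/8)^m" for m
  proof -
    let ?t = "(1/8)^m / 7 :: real"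
    have "norm (y1 - fst (x m)) \<le> ?t"
    proof (rule tendsto_upperbound)
      show "(\<lambda>k. norm (fst (x k) - fst (x m))) \<longlonglongrightarrow> norm (y1 - fst (x m))"
        by (intro tendsto_intros y1)
      show "\<forall>\<^sub>F k in sequentially. norm (fst (x k) - fst (x m)) \<le> ?t"
        using eventually_ge_at_top[of m]
      proof eventually_elim
        case (elim k)
        show ?case using norm_fst_le_m2_norm[of "m2_diff (x k) (x m)"] dist'[OF elim] by (simp add: m2_diff_def)
      qed
    qed simp
    then have 1: "(norm (y1 - fst (x m)))^2 \<le> ?t^2" by (intro power_mono) auto
    have "ennreal (LINT \<theta>:?I|lebesgue. (norm (y2 \<theta> - snd (x m) \<theta>))^2) \<le> ennreal (?t^2)"
      using fatou[of m] unfolding nn_integral_norm_power2[OF L2d, symmetric] ind .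
    then have 2: "(LINT \<theta>:?I|lebesgue. (norm (y2 \<theta> - snd (x m) \<theta>))^2) \<le> ?t^2"
      by (subst (asm) ennreal_le_iff) auto
    \<comment> \<open>Each of the two components contributes at most t^2 with t = 8^{-m}/7; the sum
      2 t^2 is rounded up to (2 t)^2, which is the origin of 2/7.\<close>
    have "(2 * ?t)^2 = 4 * ?t^2" by (simp only: power_mult_distrib) simp
    then have "(norm (y1 - fst (x m)))^2 + (LINT \<theta>:?I|lebesgue. (norm (y2 \<theta> - snd (x m) \<theta>))^2) \<le> (2 * ?t)^2"
      using 1 2 zero_le_power2[of ?t] by linarith
    then have "m2_norm (m2_diff y (x m)) \<le> sqrt ((2 * ?t)^2)"
      unfolding m2_norm_def y_def m2_diff_def fst_conv snd_conv by (rule real_sqrt_le_mono)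
    then show ?thesis by simp
  qed
  ultimately show ?thesis by blast
qed

declare split_paired_All [simp del] split_paired_Ex [simp del]

text \<open>Uniform boundedness for a sequence of seminorms, by a direct construction. A bound for a
  single n is enough, since it will be used against a sequence in which every seminorm exceeds 64^n.
  Humps of norm 8^{-n} are added one after the other; the n-th one contributes at least half of the
  operator norm \<open>N n\<close> times 8^{-n}, and all later ones can undo at most 2/7 of that
  norm times 8^{-n}.\<close>

lemma m2_gliding_hump:
  fixes p :: "nat \<Rightarrow> 'n::finite m2 \<Rightarrow> real"
  assumes tri: "\<And>n x y. in_M2 x \<Longrightarrow> in_M2 y \<Longrightarrow> p n (m2_add x y) \<le> p n x + p n y"
    and hom: "\<And>n x r. in_M2 x \<Longrightarrow> p n (m2_scale (complex_of_real r) x) = \<bar>r\<bar> * p n x"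
    and bdd: "\<And>n. \<exists>K. \<forall>x. in_M2 x \<longrightarrow> p n x \<le> K * m2_norm x"
    and ptw: "\<And>x. in_M2 x \<Longrightarrow> \<exists>C. \<forall>n. p n x \<le> C"
  shows "\<exists>n. \<forall>x. in_M2 x \<longrightarrow> p n x \<le> 64^n * m2_norm x"
proof (rule ccontr)
  assume unb: "\<not> ?thesis"
  have "\<exists>N e. N \<ge> 64^n \<and> (\<forall>x. in_M2 x \<longrightarrow> p n x \<le> N * m2_norm x) \<and> in_M2 e \<and> m2_norm e = (1/8)^n
      \<and> p n e \<ge> N / 2 * (1/8)^n" for n
  proof -
    \<comment> \<open>\<open>Q\<close> collects the admissible bounds for \<open>p n\<close>, and
      its infimum \<open>N\<close> plays the role of the operator norm. If the claim fails, every
      admissible bound is at least 64^n; since \<open>N / 2\<close> is not admissible, some vector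
      realises more than half of \<open>N\<close> and can be rescaled to norm 8^{-n}.\<close>
    define Q where "Q = {K. \<forall>x. in_M2 x \<longrightarrow> p n x \<le> K * m2_norm x}"
    have Qne: "Q \<noteq> {}" using bdd[of n] by (auto simp: Q_def)
    obtain x0 where x0: "in_M2 x0" "p n x0 > 64^n * m2_norm x0" using unb by (meson not_le)
    have Qlow: "K \<ge> 64^n" if "K \<in> Q" for K
    proof (rule ccontr)
      assume "\<not> K \<ge> 64^n"
      then have "K * m2_norm x0 \<le> 64^n * m2_norm x0" by (intro mult_right_mono) auto
      then show False using that x0 unfolding Q_def by fastforce
    qed
    define N where "N = Inf Q"
    have N64: "N \<ge> 64^n" unfolding N_def using Qne Qlow by (intro cInf_greatest) auto
    have NQ: "p n x \<le> N * m2_norm x" if x: "in_M2 x" for x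
    proof (cases "m2_norm x = 0")
      case True
      then show ?thesis using Qne x unfolding Q_def by fastforce
    next
      case False
      then have pos: "m2_norm x > 0" using m2_norm_nonneg[of x] by linarith
      have "p n x / m2_norm x \<le> N" unfolding N_def
      proof (rule cInf_greatest[OF Qne])
        fix K assume "K \<in> Q"
        then have "p n x \<le> K * m2_norm x" using x by (simp add: Q_def)
        then show "p n x / m2_norm x \<le> K" using pos by (simp add: pos_divide_le_eq)
      qed
      then show ?thesis using pos by (simp add: pos_divide_le_eq)
    qed
    have Npos: "N > 0" using N64 by (rule less_le_trans[rotated]) simp
    have "N / 2 \<notin> Q"
    proof
      assume "N / 2 \<in> Q"
      then have "N \<le> N / 2" unfolding N_def using Qlow by (intro cInf_lower bdd_belowI)
      then show False using Npos by simp
    qed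
    then obtain e where e: "in_M2 e" "p n e > N / 2 * m2_norm e" unfolding Q_def by (auto simp: not_le)
    have epos: "m2_norm e > 0"
    proof (rule ccontr)
      assume "\<not> m2_norm e > 0"
      then have "m2_norm e = 0" using m2_norm_nonneg[of e] by linarith
      then show False using NQ[OF e(1)] e(2) by simp
    qed
    define r where "r = (1/8)^n / m2_norm e"
    have r: "r > 0" using epos by (simp add: r_def)
    have re: "r * m2_norm e = (1/8)^n" using epos by (simp add: r_def)
    have "p n (m2_scale (complex_of_real r) e) \<ge> r * (N / 2 * m2_norm e)"
      using e r by (simp add: hom)
    also have "r * (N / 2 * m2_norm e) = N / 2 * (r * m2_norm e)" by simp
    finally have "p n (m2_scale (complex_of_real r) e) \<ge> N / 2 * (1/8)^n" unfolding re .
    moreover have "m2_norm (m2_scale (complex_of_real r) e) = (1/8)^n" using r re by (simp add: m2_norm_scale)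
    ultimately show ?thesis using N64 NQ in_M2_scale[OF e(1)] by blast
  qed
  then obtain N e where N: "\<And>n. N n \<ge> 64^n" "\<And>n x. in_M2 x \<Longrightarrow> p n x \<le> N n * m2_norm x"
    and e: "\<And>n. in_M2 (e n)" "\<And>n. m2_norm (e n) = (1/8)^n" "\<And>n. p n (e n) \<ge> N n / 2 * (1/8)^n"
    by metis
  \<comment> \<open>The sign of each hump is chosen so that the earlier humps do not cancel
    it.\<close>
  define xs where "xs = rec_nat (0, \<lambda>_. 0) (\<lambda>n x. if p (Suc n) (m2_add x (e (Suc n))) \<ge> p (Suc n) (e (Suc n))
     then m2_add x (e (Suc n)) else m2_diff x (e (Suc n)))"
  have xs0: "xs 0 = (0, \<lambda>_. 0)" and xsS: "\<And>n. xs (Suc n) = (if p (Suc n) (m2_add (xs n) (e (Suc n))) \<ge> p (Suc n) (e (Suc n))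
     then m2_add (xs n) (e (Suc n)) else m2_diff (xs n) (e (Suc n)))"
    by (simp_all add: xs_def)
  have xs: "in_M2 (xs n)" for n
  proof (induction n)
    case 0
    show ?case by (simp add: xs0 in_M2_def L2_on_continuous)
  next
    case (Suc n)
    then show ?case using e(1) by (simp add: xsS in_M2_add in_M2_diff)
  qed
  have step: "m2_norm (m2_diff (xs (Suc n)) (xs n)) \<le> (1/8)^Suc n" for n
  proof -
    have "m2_diff (m2_add (xs n) (e (Suc n))) (xs n) = e (Suc n)"
      "m2_diff (m2_diff (xs n) (e (Suc n))) (xs n) = m2_scale (-1) (e (Suc n))"
      by (simp_all add: m2_diff_def m2_add_def m2_scale_def)
    then show ?thesis using e(2)[of "Suc n"] by (simp add: xsS m2_norm_scale)
  qed
  have big: "p (Suc n) (xs (Suc n)) \<ge> N (Suc n) / 2 * (1/8)^Suc n" for n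
  proof -
    let ?e = "e (Suc n)" and ?p = "p (Suc n)" and ?x = "xs n"
    \<comment> \<open>From 2 e = (x + e) - (x - e), at least one of p(x + e) and p(x - e) is not
      smaller than p(e).\<close>
    have eq: "m2_scale (complex_of_real 2) ?e = m2_add (m2_add ?x ?e) (m2_scale (complex_of_real (-1)) (m2_diff ?x ?e))"
      unfolding m2_scale_def cvscale_of_real by (simp add: m2_add_def m2_diff_def scaleR_2)
    have "2 * ?p ?e = ?p (m2_scale (complex_of_real 2) ?e)" using hom[OF e(1), of "Suc n" 2 "Suc n"] by simp
    also have "\<dots> \<le> ?p (m2_add ?x ?e) + ?p (m2_diff ?x ?e)"
      unfolding eq using tri[OF in_M2_add[OF xs e(1)] in_M2_scale[OF in_M2_diff[OF xs e(1)]]]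
        hom[OF in_M2_diff[OF xs e(1)], of _ "-1"] by (metis abs_minus_cancel abs_one mult_1)
    finally have "?p (xs (Suc n)) \<ge> ?p ?e" by (simp add: xsS)
    then show ?thesis using e(3)[of "Suc n"] by linarith
  qed
  obtain y where y: "in_M2 y" "\<And>n. m2_norm (m2_diff y (xs n)) \<le> 2/7 * (1/8)^n"
    using m2_complete_geometric[OF xs step] by blast
  obtain C where C: "\<And>n. p n y \<le> C" using ptw[OF y(1)] by blast
  have "3/14 * 8^Suc n \<le> C" for n
  proof -
    let ?p = "p (Suc n)" and ?N = "N (Suc n)" and ?x = "xs (Suc n)"
    have Npos: "?N > 0" using N(1)[of "Suc n"] by (rule less_le_trans[rotated]) simp
    have eq: "?x = m2_add y (m2_scale (complex_of_real (-1)) (m2_diff y ?x))"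
      unfolding m2_scale_def cvscale_of_real by (simp add: m2_add_def m2_diff_def prod_eq_iff)
    have "?p ?x \<le> ?p y + ?p (m2_diff y ?x)"
      using tri[OF y(1) in_M2_scale[OF in_M2_diff[OF y(1) xs]], of "Suc n" "complex_of_real (-1)" "Suc n"] eq
        hom[OF in_M2_diff[OF y(1) xs], of "Suc n" "-1" "Suc n"] by simp
    moreover have "?p (m2_diff y ?x) \<le> ?N * (2/7 * (1/8)^Suc n)"
    proof -
      have "?p (m2_diff y ?x) \<le> ?N * m2_norm (m2_diff y ?x)" by (rule N(2)[OF in_M2_diff[OF y(1) xs]])
      also have "\<dots> \<le> ?N * (2/7 * (1/8)^Suc n)" using y(2)[of "Suc n"] Npos by (intro mult_left_mono) auto
      finally show ?thesis .
    qed
    \<comment> \<open>Subtracting 2/7 from 1/2 leaves 3/14, and N \<ge> 64^Suc n against the factor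
      8^{-Suc n} leaves growth like 8^Suc n.\<close>
    ultimately have "?N / 2 * (1/8)^Suc n \<le> C + ?N * (2/7 * (1/8)^Suc n)"
      using big[of n] C[of "Suc n"] by linarith
    then have "3/14 * (?N * (1/8)^Suc n) \<le> C" by (simp add: algebra_simps)
    moreover have "?N * (1/8)^Suc n \<ge> 64^Suc n * (1/8)^Suc n" by (intro mult_right_mono N(1)) simp
    moreover have "64^Suc n * (1/8)^Suc n = (8::real)^Suc n"
      by (simp only: power_mult_distrib[symmetric]) simp
    ultimately show ?thesis by linarith
  qed
  note bound = this
  obtain n where n: "14/3 * C < 8^n" using real_arch_pow[of 8 "14/3 * C"] by auto
  have "(8::real)^n \<le> 8^Suc n" by simp
  then show False using bound[of n] n by linarith
qed

subsection \<open>Orbits of the semigroup\<close>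

text \<open>A mean value inequality for one-sided derivatives. For \<epsilon> > 0, let c be the
  infimum of the times at which |g t - g 0| exceeds \<epsilon> t. By continuity the estimate still
  holds at c, and the right derivative there extends it beyond c, contradicting the infimum.\<close>

lemma zero_right_derivative_imp_eq:
  fixes g :: "real \<Rightarrow> 'a::real_normed_vector"
  assumes T: "0 \<le> T" and cont: "continuous_on {0..T} g"
    and der: "\<And>t. t \<in> {0..<T} \<Longrightarrow> (g has_vector_derivative 0) (at t within {t..})"
  shows "g T = g 0"
proof -
  have bound: "norm (g T - g 0) \<le> \<epsilon> * T" if \<epsilon>: "\<epsilon> > 0" for \<epsilon>
  proof (rule ccontr)
    assume neg: "\<not> ?thesis"
    define h where "h t = norm (g t - g 0) - \<epsilon> * t" for t
    have hc: "continuous_on {0..T} h" unfolding h_def by (intro continuous_intros cont)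
    define U where "U = {t\<in>{0..T}. h t > 0}"
    have TU: "T \<in> U" using neg T by (simp add: U_def h_def)
    define c where "c = Inf U"
    have bdd: "bdd_below U" by (rule bdd_belowI[of _ 0]) (auto simp: U_def)
    have c: "0 \<le> c" "c \<le> T"
      using TU bdd unfolding c_def by (auto intro!: cInf_greatest cInf_lower simp: U_def)
    have below: "t \<notin> U" if "t < c" for t
      using that cInf_lower[OF _ bdd, of t] unfolding c_def by auto
    have hc0: "h c \<le> 0"
    proof (rule ccontr)
      assume pos: "\<not> h c \<le> 0"
      then have "c \<noteq> 0" by (auto simp: h_def)
      then have c0: "c > 0" using c by simp
      obtain d where d: "d > 0" "\<And>t. t \<in> {0..T} \<Longrightarrow> dist t c < d \<Longrightarrow> dist (h t) (h c) < h c"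
        using hc c pos unfolding continuous_on_iff by (metis atLeastAtMost_iff not_le)
      \<comment> \<open>A point to the left of c, kept in the interval by the maximum; by continuity
        h would already be positive there.\<close>
      let ?t = "max 0 (c - d/2)"
      have t: "?t \<in> {0..T}" "dist ?t c < d" "?t < c" using c c0 d(1) by (auto simp: dist_real_def)
      then have "h ?t > 0" using d(2)[OF t(1,2)] by (simp add: dist_real_def)
      then show False using below[OF t(3)] t(1) by (simp add: U_def)
    qed
    have "c \<notin> U" using hc0 by (simp add: U_def)
    then have cT: "c < T" using c TU by (metis order_le_less)
    then obtain d where d: "d > 0" "\<And>y. y \<ge> c \<Longrightarrow> norm (y - c) < d \<Longrightarrow> norm (g y - g c) \<le> \<epsilon> * norm (y - c)"
      using der[of c] c \<epsilon> unfolding has_vector_derivative_def has_derivative_within_alt by auto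
    have "Inf U < c + d" using d(1) by (simp add: c_def)
    then obtain t where t: "t \<in> U" "t < c + d" using TU cInf_lessD by blast
    have "t > c" using below[of t] t(1) \<open>c \<notin> U\<close> by (metis linorder_neqE_linordered_idom)
    then have "norm (g t - g c) \<le> \<epsilon> * (t - c)" using d(2)[of t] t(2) by simp
    \<comment> \<open>The increment of the norm is at most \<epsilon> (t - c), which is what the
      linear term of h subtracts.\<close>
    then have "h t \<le> h c" using norm_triangle_ineq[of "g t - g c" "g c - g 0"] by (simp add: h_def algebra_simps)
    then show False using hc0 t(1) by (simp add: U_def)
  qed
  have "norm (g T - g 0) \<le> 0"
  proof (rule field_le_epsilon)
    fix e :: real assume "e > 0"
    then have "norm (g T - g 0) \<le> e / (T + 1) * T" using T by (intro bound) simp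
    also have "\<dots> \<le> e" using T \<open>e > 0\<close> by (simp add: field_simps)
    finally show "norm (g T - g 0) \<le> 0 + e" by simp
  qed
  then show ?thesis by simp
qed

text \<open>Integrating factor exp(- lam t), whose product with f has right derivative zero.\<close>

lemma right_derivative_linear_imp_exp:
  fixes f :: "real \<Rightarrow> complex"
  assumes T: "0 \<le> T" and cont: "continuous_on {0..T} f"
    and der: "\<And>t. t \<in> {0..<T} \<Longrightarrow> (f has_vector_derivative lam * f t) (at t within {t..})"
  shows "f T = exp (lam * of_real T) * f 0"
proof -
  let ?g = "\<lambda>t. exp (- lam * complex_of_real t) * f t"
  have "?g T = ?g 0"
  proof (rule zero_right_derivative_imp_eq[OF T])
    show "continuous_on {0..T} ?g" by (intro continuous_intros cont)
    fix t assume t: "t \<in> {0..<T}"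
    have e: "((\<lambda>t. exp (- lam * complex_of_real t)) has_vector_derivative - lam * exp (- lam * complex_of_real t)) (at t within {t..})"
      by (auto intro!: derivative_eq_intros has_vector_derivative_real_field)
    show "(?g has_vector_derivative 0) (at t within {t..})"
      using has_vector_derivative_mult[OF e der[OF t]] by (simp add: algebra_simps)
  qed
  then show ?thesis by (simp add: exp_minus field_simps)
qed

section \<open>Local boundedness and continuity of a C0-semigroup\<close>

context
  fixes S :: "real \<Rightarrow> 'n::finite m2 \<Rightarrow> 'n m2"
  assumes S: "is_C0_semigroup S"
begin

lemmas sg_props = S[unfolded is_C0_semigroup_def]

lemma sg_in_M2: "t \<ge> 0 \<Longrightarrow> in_M2 x \<Longrightarrow> in_M2 (S t x)"
  using sg_props[THEN conjunct1] by blast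

lemma sg_linear: "t \<ge> 0 \<Longrightarrow> in_M2 x \<Longrightarrow> in_M2 y \<Longrightarrow>
    m2_equiv (S t (m2_add (m2_scale a x) (m2_scale b y))) (m2_add (m2_scale a (S t x)) (m2_scale b (S t y)))"
  using sg_props[THEN conjunct2, THEN conjunct2, THEN conjunct1] by blast

lemma sg_bounded: "t \<ge> 0 \<Longrightarrow> \<exists>M. \<forall>x. in_M2 x \<longrightarrow> m2_norm (S t x) \<le> M * m2_norm x"
  using sg_props[THEN conjunct2, THEN conjunct2, THEN conjunct2, THEN conjunct1] by blast

lemma sg_zero: "in_M2 x \<Longrightarrow> m2_equiv (S 0 x) x"
  using sg_props[THEN conjunct2, THEN conjunct2, THEN conjunct2, THEN conjunct2, THEN conjunct1] by blast

lemma sg_plus: "t \<ge> 0 \<Longrightarrow> s \<ge> 0 \<Longrightarrow> in_M2 x \<Longrightarrow> m2_equiv (S (t + s) x) (S t (S s x))"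
  using sg_props[THEN conjunct2, THEN conjunct2, THEN conjunct2, THEN conjunct2, THEN conjunct2, THEN conjunct1]
  by blast

lemma sg_tendsto: "in_M2 x \<Longrightarrow> ((\<lambda>t. m2_norm (m2_diff (S t x) x)) \<longlongrightarrow> 0) (at_right 0)"
  using sg_props[THEN conjunct2, THEN conjunct2, THEN conjunct2, THEN conjunct2, THEN conjunct2, THEN conjunct2]
  by blast

lemma sg_diff: "t \<ge> 0 \<Longrightarrow> in_M2 x \<Longrightarrow> in_M2 y \<Longrightarrow> m2_equiv (S t (m2_diff x y)) (m2_diff (S t x) (S t y))"
  unfolding m2_diff_conv by (rule sg_linear)

lemma sg_scale:
  assumes "t \<ge> 0" "in_M2 x" shows "m2_equiv (S t (m2_scale a x)) (m2_scale a (S t x))"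
proof -
  have "m2_add (m2_scale a z) (m2_scale 0 z) = m2_scale a z" for z :: "'n m2"
    by (simp add: m2_add_def m2_scale_def)
  then show ?thesis using sg_linear[OF assms(1,2,2), of a 0] by simp
qed

lemma sg_add:
  assumes "t \<ge> 0" "in_M2 x" "in_M2 y" shows "m2_equiv (S t (m2_add x y)) (m2_add (S t x) (S t y))"
proof -
  have "m2_scale 1 z = z" for z :: "'n m2" by (simp add: m2_scale_def)
  then show ?thesis using sg_linear[OF assms, of 1 1] by simp
qed

lemma sg_norm_diff_le:
  assumes "in_M2 x" "t \<ge> 0"
  shows "m2_norm (S t x) \<le> m2_norm (m2_diff (S t x) x) + m2_norm x"
proof -
  have "S t x = m2_add (m2_diff (S t x) x) x" by (simp add: m2_add_def m2_diff_def)
  then show ?thesis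
    using m2_norm_add_le[OF in_M2_diff[OF sg_in_M2[OF assms(2,1)] assms(1)] assms(1)] by simp
qed

text \<open>Otherwise there are times h n tending to 0 at which the norm of S (h n) exceeds 64^n.
  Strong continuity at 0 bounds each orbit along this sequence, so the gliding hump lemma applies to
  p n x = \<open>m2_norm (S (h n) x)\<close> and contradicts the choice.\<close>

lemma sg_locally_bounded:
  "\<exists>\<delta>>0. \<exists>M. \<forall>h\<in>{0..\<delta>}. \<forall>x. in_M2 x \<longrightarrow> m2_norm (S h x) \<le> M * m2_norm x"
proof (rule ccontr)
  assume "\<not> ?thesis"
  then have "\<exists>h\<in>{0..1 / real (Suc n)}. \<exists>x. in_M2 x \<and> m2_norm (S h x) > 64^n * m2_norm x" for n
    by (metis not_le of_nat_0_less_iff zero_less_Suc zero_less_divide_1_iff)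
  then obtain h where h: "\<And>n. h n \<in> {0..1 / real (Suc n)}"
    and big: "\<And>n. \<exists>x. in_M2 x \<and> m2_norm (S (h n) x) > 64^n * m2_norm x"
    by metis
  \<comment> \<open>Convergence in \<open>at_right 0\<close> requires times different from 0. At
    time 0 the semigroup is the identity, whose norm 1 does not exceed 64^n.\<close>
  have hpos: "h n > 0" for n
  proof (rule ccontr)
    assume "\<not> h n > 0"
    then have h0: "h n = 0" using h[of n] by simp
    obtain x where x: "in_M2 x" "m2_norm (S (h n) x) > 64^n * m2_norm x" using big by blast
    have "m2_norm (S 0 x) = m2_norm x"
      by (rule m2_norm_cong[OF sg_in_M2[OF _ x(1)] x(1) sg_zero[OF x(1)]]) simp
    moreover have "1 * m2_norm x \<le> 64^n * m2_norm x" by (intro mult_right_mono) auto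
    ultimately show False using x(2) h0 by simp
  qed
  then have h0: "h n \<ge> 0" for n by (simp add: less_imp_le)
  have "h \<longlonglongrightarrow> 0"
  proof (rule tendsto_sandwich)
    show "\<forall>\<^sub>F n in sequentially. 0 \<le> h n" "\<forall>\<^sub>F n in sequentially. h n \<le> inverse (real (Suc n))"
      using h by (auto intro!: always_eventually simp: inverse_eq_divide)
  qed (rule tendsto_const, rule LIMSEQ_inverse_real_of_nat)
  then have hlim: "filterlim h (at_right 0) sequentially"
    by (simp add: filterlim_at hpos less_imp_neq[OF hpos, symmetric])
  have "\<exists>n. \<forall>x. in_M2 x \<longrightarrow> m2_norm (S (h n) x) \<le> 64^n * m2_norm x"
  proof (rule m2_gliding_hump)
    fix n and x y :: "'n m2" assume x: "in_M2 x" and y: "in_M2 y"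
    have "m2_norm (S (h n) (m2_add x y)) = m2_norm (m2_add (S (h n) x) (S (h n) y))"
      using x y h0 by (intro m2_norm_cong sg_add sg_in_M2 in_M2_add)
    also have "\<dots> \<le> m2_norm (S (h n) x) + m2_norm (S (h n) y)"
      using x y h0 by (intro m2_norm_add_le sg_in_M2)
    finally show "m2_norm (S (h n) (m2_add x y)) \<le> m2_norm (S (h n) x) + m2_norm (S (h n) y)" .
  next
    fix n and x :: "'n m2" and r assume x: "in_M2 x"
    have "m2_norm (S (h n) (m2_scale (complex_of_real r) x)) = m2_norm (m2_scale (complex_of_real r) (S (h n) x))"
      using x h0 by (intro m2_norm_cong sg_scale sg_in_M2 in_M2_scale)
    then show "m2_norm (S (h n) (m2_scale (complex_of_real r) x)) = \<bar>r\<bar> * m2_norm (S (h n) x)"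
      by (simp add: m2_norm_scale)
  next
    fix n show "\<exists>K. \<forall>x. in_M2 x \<longrightarrow> m2_norm (S (h n) x) \<le> K * m2_norm x"
      by (rule sg_bounded[OF h0])
  next
    fix x :: "'n m2" assume x: "in_M2 x"
    have "(\<lambda>n. m2_norm (m2_diff (S (h n) x) x)) \<longlonglongrightarrow> 0"
      by (rule filterlim_compose[OF sg_tendsto[OF x] hlim])
    then have "Bseq (\<lambda>n. m2_norm (m2_diff (S (h n) x) x))" by (intro convergent_imp_Bseq convergentI)
    then obtain K where "\<And>n. norm (m2_norm (m2_diff (S (h n) x) x)) \<le> K" by (rule BseqE) blast
    then have "m2_norm (S (h n) x) \<le> K + m2_norm x" for n
      using sg_norm_diff_le[OF x h0[of n]] by (smt (verit) real_norm_def)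
    then show "\<exists>C. \<forall>n. m2_norm (S (h n) x) \<le> C" by blast
  qed
  then show False using big by (meson not_le)
qed

text \<open>An interval of length k \<delta> is crossed in k steps, each costing a factor M. Taking
  M \<ge> 1 lets one power serve all shorter times.\<close>

lemma sg_bounded_on:
  "\<exists>M\<ge>0. \<forall>s\<in>{0..t}. \<forall>x. in_M2 x \<longrightarrow> m2_norm (S s x) \<le> M * m2_norm x"
proof -
  obtain \<delta> M0 where \<delta>: "\<delta> > 0" and M0: "\<And>h x. h \<in> {0..\<delta>} \<Longrightarrow> in_M2 x \<Longrightarrow> m2_norm (S h x) \<le> M0 * m2_norm x"
    using sg_locally_bounded by blast
  define M where "M = max 1 M0"
  have M1: "M \<ge> 1" by (simp add: M_def)
  have M: "m2_norm (S h x) \<le> M * m2_norm x" if "h \<in> {0..\<delta>}" "in_M2 x" for h x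
    by (rule order_trans[OF M0[OF that]], rule mult_right_mono) (auto simp: M_def)
  have b: "m2_norm (S s x) \<le> M^k * m2_norm x" if "s \<in> {0..real k * \<delta>}" "in_M2 x" for k s x
    using that
  proof (induction k arbitrary: s x)
    case 0
    then have "m2_norm (S s x) = m2_norm x"
      using m2_norm_cong[OF sg_in_M2[OF _ 0(2)] 0(2) sg_zero[OF 0(2)]] by simp
    then show ?case by simp
  next
    case (Suc k)
    show ?case
    proof (cases "s \<le> real k * \<delta>")
      case True
      then have "m2_norm (S s x) \<le> M^k * m2_norm x" using Suc by simp
      also have "\<dots> \<le> M^Suc k * m2_norm x" using M1 by (intro mult_right_mono power_increasing) auto
      finally show ?thesis .
    next
      case False
      define r where "r = s - real k * \<delta>"
      have r: "r \<in> {0..\<delta>}" using False Suc.prems by (simp add: r_def algebra_simps)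
      have k0: "real k * \<delta> \<ge> 0" using \<delta> by simp
      have kin: "in_M2 (S (real k * \<delta>) x)" using sg_in_M2[OF k0 Suc.prems(2)] .
      have "m2_norm (S s x) = m2_norm (S r (S (real k * \<delta>) x))"
        using sg_plus[of r "real k * \<delta>" x] r k0 Suc.prems
        by (intro m2_norm_cong sg_in_M2 kin) (auto simp: r_def)
      also have "\<dots> \<le> M * m2_norm (S (real k * \<delta>) x)" by (rule M[OF r kin])
      also have "\<dots> \<le> M * (M^k * m2_norm x)" using M1 k0 Suc by (intro mult_left_mono Suc.IH) auto
      finally show ?thesis by simp
    qed
  qed
  obtain k :: nat where k: "t / \<delta> < real k" using reals_Archimedean2 by blast
  then have "t \<le> real k * \<delta>" using \<delta> by (simp add: field_simps)
  then have "\<forall>s\<in>{0..t}. \<forall>x. in_M2 x \<longrightarrow> m2_norm (S s x) \<le> M^k * m2_norm x"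
    using b by auto
  then show ?thesis using M1 by (intro exI[of _ "M^k"]) auto
qed

text \<open>S(b) x - S(a) x = S(a) (S(b - a) x - x) for a \<le> b. With a bound on S(a) uniform in
  a, strong continuity at 0 controls approach from both sides, in particular from the left, where a
  moves with the limit.\<close>

lemma continuous_on_orbit:
  assumes x: "in_M2 x" and \<psi>: "in_M2 \<psi>"
  shows "continuous_on {0..T} (\<lambda>t. m2_inner (S t x) \<psi>)"
proof -
  obtain M where M: "M \<ge> 0" "\<And>s x. s \<in> {0..T} \<Longrightarrow> in_M2 x \<Longrightarrow> m2_norm (S s x) \<le> M * m2_norm x"
    using sg_bounded_on[of T] by blast
  \<comment> \<open>The summand 1 only keeps K positive, so that e / K is a legitimate
    tolerance.\<close>
  define K where "K = 2 * m2_norm \<psi> * M + 1"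
  have K: "K > 0" using M(1) by (simp add: K_def add_nonneg_pos)
  have le: "cmod (m2_inner (S b x) \<psi> - m2_inner (S a x) \<psi>) \<le> K * m2_norm (m2_diff (S (b - a) x) x)"
    if ab: "0 \<le> a" "a \<le> b" "b \<le> T" for a b
  proof -
    let ?d = "m2_diff (S (b - a) x) x"
    have Sx: "in_M2 (S (b - a) x)" "in_M2 (S a x)" "in_M2 (S b x)" using ab by (auto intro: sg_in_M2 x)
    have d: "in_M2 ?d" using Sx x by (intro in_M2_diff)
    have "m2_inner (S b x) \<psi> = m2_inner (S a (S (b - a) x)) \<psi>"
      using sg_plus[of a "b - a" x] ab x Sx by (intro m2_inner_cong sg_in_M2 \<psi>) auto
    then have "m2_inner (S b x) \<psi> - m2_inner (S a x) \<psi> = m2_inner (m2_diff (S a (S (b - a) x)) (S a x)) \<psi>"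
      using ab Sx x by (simp add: m2_inner_diff_left sg_in_M2 \<psi>)
    also have "\<dots> = m2_inner (S a ?d) \<psi>"
      using ab Sx x by (intro m2_inner_cong in_M2_diff sg_in_M2 \<psi> m2_equiv_sym[OF sg_diff]) auto
    finally have "cmod (m2_inner (S b x) \<psi> - m2_inner (S a x) \<psi>) \<le> 2 * m2_norm \<psi> * m2_norm (S a ?d)"
      using m2_inner_bound[OF sg_in_M2[OF ab(1) d] \<psi>] by simp
    also have "\<dots> \<le> 2 * m2_norm \<psi> * (M * m2_norm ?d)" using ab d by (intro mult_left_mono M) auto
    also have "\<dots> \<le> K * m2_norm ?d" by (simp add: K_def algebra_simps)
    finally show ?thesis .
  qed
  show ?thesis unfolding continuous_on_iff
  proof (intro ballI allI impI)
    fix t e :: real assume t: "t \<in> {0..T}" and e: "e > 0"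
    have "\<forall>\<^sub>F h in at_right 0. m2_norm (m2_diff (S h x) x) < e / K"
      using sg_tendsto[OF x] e K by (intro order_tendstoD) auto
    then obtain d where d: "d > 0" "\<And>h. 0 < h \<Longrightarrow> h < d \<Longrightarrow> m2_norm (m2_diff (S h x) x) < e / K"
      unfolding eventually_at_right_field by auto
    have main: "dist (m2_inner (S b x) \<psi>) (m2_inner (S a x) \<psi>) < e" if "0 \<le> a" "a < b" "b \<le> T" "b - a < d" for a b
    proof -
      have "cmod (m2_inner (S b x) \<psi> - m2_inner (S a x) \<psi>) \<le> K * m2_norm (m2_diff (S (b - a) x) x)"
        using that by (intro le) auto
      also have "\<dots> < K * (e / K)" using that K by (intro mult_strict_left_mono d) auto
      finally show ?thesis using K by (simp add: dist_norm)
    qed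
    show "\<exists>d>0. \<forall>x'\<in>{0..T}. dist x' t < d \<longrightarrow> dist (m2_inner (S x' x) \<psi>) (m2_inner (S t x) \<psi>) < e"
    proof (intro exI[of _ d] conjI ballI impI d)
      fix s assume s: "s \<in> {0..T}" "dist s t < d"
      consider "s < t" | "s = t" | "s > t" by linarith
      then show "dist (m2_inner (S s x) \<psi>) (m2_inner (S t x) \<psi>) < e"
      proof cases
        case 1 then show ?thesis using main[of s t] s t by (simp add: dist_commute dist_real_def)
      next
        case 2 then show ?thesis using e by simp
      next
        case 3 then show ?thesis using main[of t s] s t by (simp add: dist_real_def)
      qed
    qed
  qed
qed

end

section \<open>Pairings of orbits in D(A) with an adjoint eigenvector\<close>

lemma opA_rel_in_M2:
  assumes "opA_rel Am1 A2 A3 x v" shows "in_M2 x" "in_M2 v"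
  using assms unfolding opA_rel_def by (auto simp: in_M2_def Let_def)

text \<open>D(A) is invariant under S(t), with A S(t) x = S(t) A x. The pairing with \<psi>
  therefore solves f' = lam f in the sense of right derivatives.\<close>

lemma m2_inner_orbit_eq_exp:
  assumes gen: "generated_by_A Am1 A2 A3 S" and \<psi>: "in_M2 \<psi>"
    and eig: "\<And>x v. opA_rel Am1 A2 A3 x v \<Longrightarrow> m2_inner v \<psi> = lam * m2_inner x \<psi>"
    and xv: "opA_rel Am1 A2 A3 x v" and T: "T \<ge> 0"
  shows "m2_inner (S T x) \<psi> = exp (lam * complex_of_real T) * m2_inner x \<psi>"
proof -
  have S: "is_C0_semigroup S" using gen by (simp add: generated_by_A_def)
  let ?q = "\<lambda>x v h. m2_diff (m2_scale (complex_of_real (1 / h)) (m2_diff (S h x) x)) v"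
  have iff: "((\<lambda>h. m2_norm (?q x v h)) \<longlongrightarrow> 0) (at_right 0) \<longleftrightarrow> (\<exists>v'. opA_rel Am1 A2 A3 x v' \<and> m2_equiv v v')"
    if "in_M2 x" "in_M2 v" for x v
    using gen that unfolding generated_by_A_def by blast
  note x = opA_rel_in_M2(1)[OF xv] and v = opA_rel_in_M2(2)[OF xv]
  note inM = sg_in_M2[OF S]
  have qin: "in_M2 (?q x v h)" if "in_M2 x" "in_M2 v" "h > 0" for x v h
    using that by (intro in_M2_diff in_M2_scale inM) auto
  have q0: "((\<lambda>h. m2_norm (?q x v h)) \<longlongrightarrow> 0) (at_right 0)"
    using iff[OF x v] xv m2_equiv_refl by blast
  \<comment> \<open>S(t) commutes with the difference quotient up to \<open>m2_equiv\<close> and is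
    bounded, so the quotient of S(t) x converges to S(t) v.\<close>
  have qt: "((\<lambda>h. m2_norm (?q (S t x) (S t v) h)) \<longlongrightarrow> 0) (at_right 0)" if t: "t \<ge> 0" for t
  proof -
    obtain M where M: "\<And>x. in_M2 x \<Longrightarrow> m2_norm (S t x) \<le> M * m2_norm x"
      using sg_bounded[OF S t] by blast
    have le: "m2_norm (?q (S t x) (S t v) h) \<le> M * m2_norm (?q x v h)" if h: "h > 0" for h
    proof -
      have h': "h \<ge> 0" using h by simp
      let ?c = "complex_of_real (1 / h)"
      note ins = x v inM[OF t x] inM[OF t v] inM[OF h' x] inM[OF h' inM[OF t x]] inM[OF t inM[OF h' x]]
      have "m2_equiv (S h (S t x)) (S (h + t) x)" by (rule m2_equiv_sym[OF sg_plus[OF S h' t x]])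
      moreover have "m2_equiv (S (h + t) x) (S t (S h x))" using sg_plus[OF S t h' x] by (simp add: add.commute)
      ultimately have e1: "m2_equiv (S h (S t x)) (S t (S h x))" by (rule m2_equiv_trans)
      have "m2_equiv (m2_diff (S h (S t x)) (S t x)) (S t (m2_diff (S h x) x))"
        by (rule m2_equiv_trans[OF m2_equiv_diff[OF e1 m2_equiv_refl] m2_equiv_sym[OF sg_diff[OF S t ins(5) x]]])
      then have "m2_equiv (m2_scale ?c (m2_diff (S h (S t x)) (S t x))) (S t (m2_scale ?c (m2_diff (S h x) x)))"
        by (intro m2_equiv_trans[OF m2_equiv_scale m2_equiv_sym[OF sg_scale[OF S t in_M2_diff[OF ins(5) x]]]])
      then have "m2_equiv (?q (S t x) (S t v) h) (S t (?q x v h))"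
        by (intro m2_equiv_trans[OF m2_equiv_diff[OF _ m2_equiv_refl]
              m2_equiv_sym[OF sg_diff[OF S t in_M2_scale[OF in_M2_diff[OF ins(5) x]] v]]])
      then have "m2_norm (?q (S t x) (S t v) h) = m2_norm (S t (?q x v h))"
        by (rule m2_norm_cong[OF qin[OF ins(3,4) h] inM[OF t qin[OF x v h]]])
      also have "\<dots> \<le> M * m2_norm (?q x v h)" by (rule M[OF qin[OF x v h]])
      finally show ?thesis .
    qed
    show ?thesis
    proof (rule tendsto_sandwich[of "\<lambda>_. 0" _ _ "\<lambda>h. M * m2_norm (?q x v h)"])
      show "\<forall>\<^sub>F h in at_right 0. m2_norm (?q (S t x) (S t v) h) \<le> M * m2_norm (?q x v h)"
        using eventually_at_right_less[of 0] by eventually_elim (rule le)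
      show "((\<lambda>h. M * m2_norm (?q x v h)) \<longlongrightarrow> 0) (at_right 0)"
        using tendsto_mult_left[OF q0, of M] by simp
    qed auto
  qed
  let ?f = "\<lambda>t. m2_inner (S t x) \<psi>"
  have der: "(?f has_vector_derivative lam * ?f t) (at t within {t..})" if t: "t \<in> {0..<T}" for t
  proof -
    have t0: "t \<ge> 0" using t by simp
    note zin = inM[OF t0 x] inM[OF t0 v]
    \<comment> \<open>The equivalence in \<open>generated_by_A\<close>, read from convergence to
      membership, puts S(t) x into D(A) and identifies S(t) v with its image under A; only there
      does the eigenvector relation apply.\<close>
    obtain v' where v': "opA_rel Am1 A2 A3 (S t x) v'" "m2_equiv (S t v) v'"
      using iff[OF zin] qt[OF t0] by blast
    have vt: "m2_inner (S t v) \<psi> = lam * ?f t"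
      using m2_inner_cong[OF zin(2) opA_rel_in_M2(2)[OF v'(1)] \<psi> v'(2)] eig[OF v'(1)] by simp
    define K where "K = 2 * m2_norm \<psi> + 1"
    have K: "K > 0" by (simp add: K_def add_nonneg_pos)
    have le: "cmod (?f (t + h) - ?f t - h *\<^sub>R (lam * ?f t)) \<le> h * (K * m2_norm (?q (S t x) (S t v) h))"
      if h: "h > 0" for h
    proof -
      let ?w = "?q (S t x) (S t v) h"
      have h': "h \<ge> 0" using h by simp
      have "?f (t + h) = m2_inner (S h (S t x)) \<psi>"
        using sg_plus[OF S h' t0 x] h' t0 by (intro m2_inner_cong inM \<psi> x) (auto simp: add.commute)
      then have "m2_inner ?w \<psi> = (?f (t + h) - ?f t) / complex_of_real h - lam * ?f t"
        using zin inM[OF h' zin(1)]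
        by (simp add: m2_inner_diff_left m2_inner_scale_left in_M2_diff in_M2_scale \<psi> vt)
      then have eq: "?f (t + h) - ?f t - h *\<^sub>R (lam * ?f t) = complex_of_real h * m2_inner ?w \<psi>"
        using h by (simp add: scaleR_conv_of_real field_simps)
      have "cmod (m2_inner ?w \<psi>) \<le> 2 * m2_norm \<psi> * m2_norm ?w"
        by (rule m2_inner_bound[OF qin[OF zin h] \<psi>])
      also have "\<dots> \<le> K * m2_norm ?w" by (intro mult_right_mono) (auto simp: K_def)
      finally show ?thesis unfolding eq norm_mult using h by simp
    qed
    show ?thesis
      unfolding has_vector_derivative_def has_derivative_within_alt
    proof (intro conjI allI impI)
      show "bounded_linear (\<lambda>h. h *\<^sub>R (lam * ?f t))" by (rule bounded_linear_scaleR_left)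
      fix e :: real assume e: "e > 0"
      have "\<forall>\<^sub>F h in at_right 0. m2_norm (?q (S t x) (S t v) h) < e / K"
        using qt[OF t0] e K by (intro order_tendstoD) auto
      then obtain d where d: "d > 0" "\<And>h. 0 < h \<Longrightarrow> h < d \<Longrightarrow> m2_norm (?q (S t x) (S t v) h) < e / K"
        unfolding eventually_at_right_field by auto
      show "\<exists>d>0. \<forall>y\<in>{t..}. norm (y - t) < d \<longrightarrow> norm (?f y - ?f t - (y - t) *\<^sub>R (lam * ?f t)) \<le> e * norm (y - t)"
      proof (intro exI[of _ d] conjI ballI impI d)
        fix y assume y: "y \<in> {t..}" "norm (y - t) < d"
        show "norm (?f y - ?f t - (y - t) *\<^sub>R (lam * ?f t)) \<le> e * norm (y - t)"
        proof (cases "y = t")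
          case False
          define h where "h = y - t"
          have h: "h > 0" "h < d" "y = t + h" using y False by (auto simp: h_def)
          have "norm (?f y - ?f t - (y - t) *\<^sub>R (lam * ?f t)) \<le> h * (K * m2_norm (?q (S t x) (S t v) h))"
            using le[OF h(1)] h(3) by simp
          also have "\<dots> \<le> h * (K * (e / K))" using d(2)[OF h(1,2)] h(1) K by (intro mult_left_mono) auto
          also have "\<dots> = e * norm (y - t)" using K h by simp
          finally show ?thesis .
        qed simp
      qed
    qed
  qed
  have "?f T = exp (lam * complex_of_real T) * ?f 0"
    by (rule right_derivative_linear_imp_exp[OF T continuous_on_orbit[OF S x \<psi>] der])
  moreover have "?f 0 = m2_inner x \<psi>"
    using sg_zero[OF S x] by (intro m2_inner_cong inM x \<psi>) auto
  ultimately show ?thesis by simp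
qed

subsection \<open>An eigenvector of the adjoint\<close>

text \<open>Pulls the functional y* under the integral and turns it into the row y* A(s), whose
  entries are the scalar coefficients of the integration by parts.\<close>

lemma integral_matrix_vector_functional:
  fixes A :: "real \<Rightarrow> complex^'n::finite^'n" and w :: "real \<Rightarrow> complex^'n" and y :: "complex^'n"
  assumes A: "\<forall>i j. L2_on {a..b} (\<lambda>s. A s $ i $ j)" and w: "L2_on {a..b} w"
  shows "(\<Sum>i\<in>UNIV. integral {a..b} (\<lambda>s. A s *v w s) $ i * cnj (y $ i))
    = integral {a..b} (\<lambda>s. \<Sum>j\<in>UNIV. (\<Sum>i\<in>UNIV. cnj (y $ i) * A s $ i $ j) * w s $ j)"
proof -
  let ?L = "\<lambda>u :: complex^'n. \<Sum>i\<in>UNIV. u $ i * cnj (y $ i)"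
  have L: "bounded_linear ?L"
    unfolding linear_conv_bounded_linear[symmetric]
    by (rule linearI) (simp_all add: distrib_right sum.distrib scaleR_sum_right)
  have "bilinear ((*v) :: complex^'n^'n \<Rightarrow> complex^'n \<Rightarrow> complex^'n)"
    unfolding bilinear_def
    by (auto intro!: linearI simp: vec_eq_iff matrix_vector_mult_def distrib_left distrib_right sum.distrib scaleR_sum_right)
  then have bb: "bounded_bilinear ((*v) :: complex^'n^'n \<Rightarrow> complex^'n \<Rightarrow> complex^'n)"
    by (simp add: bilinear_conv_bounded_bilinear)
  have "L2_on {a..b} A" using A by (simp add: L2_on_vec_iff)
  then have "(\<lambda>s. A s *v w s) absolutely_integrable_on {a..b}"
    using w bb by (rule L2_on_bilinear_integrable)
  then have "(\<lambda>s. A s *v w s) integrable_on {a..b}" by (simp add: absolutely_integrable_on_def)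
  from integral_linear[OF this L]
  have "?L (integral {a..b} (\<lambda>s. A s *v w s)) = integral {a..b} (\<lambda>s. ?L (A s *v w s))"
    by (simp add: o_def)
  also have "(\<lambda>s. ?L (A s *v w s)) = (\<lambda>s. \<Sum>j\<in>UNIV. (\<Sum>i\<in>UNIV. cnj (y $ i) * A s $ i $ j) * w s $ j)"
  proof
    fix s
    have "?L (A s *v w s) = (\<Sum>i\<in>UNIV. \<Sum>j\<in>UNIV. cnj (y $ i) * A s $ i $ j * w s $ j)"
      by (simp add: matrix_vector_mult_def sum_distrib_left sum_distrib_right mult_ac)
    also have "\<dots> = (\<Sum>j\<in>UNIV. \<Sum>i\<in>UNIV. cnj (y $ i) * A s $ i $ j * w s $ j)" by (rule sum.swap)
    finally show "?L (A s *v w s) = (\<Sum>j\<in>UNIV. (\<Sum>i\<in>UNIV. cnj (y $ i) * A s $ i $ j) * w s $ j)"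
      by (simp add: sum_distrib_right)
  qed
  finally show ?thesis .
qed

lemma AC_with_indefinite_integral:
  fixes w :: "real \<Rightarrow> complex^'n::finite"
  assumes w: "L2_on {a..b} w"
  shows "AC_with a b (\<lambda>t. (c + integral {a..t} w) $ j) (\<lambda>t. w t $ j)"
  unfolding AC_with_def
proof (intro conjI ballI)
  show "(\<lambda>t. w t $ j) absolutely_integrable_on {a..b}"
    using w by (intro L2_on_absolutely_integrable) (simp add: L2_on_vec_iff)
  fix t assume t: "t \<in> {a..b}"
  have "w integrable_on {a..b}" using L2_on_absolutely_integrable[OF w] by (simp add: absolutely_integrable_on_def)
  then have "w integrable_on {a..t}" by (rule integrable_on_subinterval) (use t in auto)
  from integral_linear[OF this bounded_linear_vec_nth, of j]
  show "(c + integral {a..t} w) $ j = (c + integral {a..a} w) $ j + integral {a..t} (\<lambda>t. w t $ j)"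
    by (simp add: o_def)
qed

lemma L2_on_cmult:
  fixes f :: "real \<Rightarrow> complex" shows "L2_on S f \<Longrightarrow> L2_on S (\<lambda>x. c * f x)"
  by (rule L2_on_linear[where h="\<lambda>z. c * z"]) (auto intro: linearI simp: algebra_simps)

lemma L2_on_cnj:
  "L2_on S f \<Longrightarrow> L2_on S (\<lambda>x. cnj (f x))"
  by (rule L2_on_linear[where h=cnj]) (auto intro: bounded_linear.linear bounded_linear_cnj)

lemma L2_on_diff:
  fixes f g :: "real \<Rightarrow> complex"
  assumes "L2_on S f" "L2_on S g" shows "L2_on S (\<lambda>x. f x - g x)"
  using L2_on_add[OF assms(1) L2_on_cmult[OF assms(2), of "-1"]] by simp

text \<open>Write a2 = y* A2, a3 = y* A3, p for the conjugate of \<psi>2, and q = p + a2. With w =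
  z' the pairing (A x, \<psi>) is the integral of q w + a3 z, that is, q(0) z(0) - q(-1) z(-1) plus
  the integral of (a3 - q') z. It equals lam (x, \<psi>) if q' = a3 - lam p = a3 + lam a2 - lam q
  and the two boundary values are the prescribed ones.\<close>

lemma adjoint_eigenvector_exists:
  fixes Am1 :: "real^'n::finite^'n" and A2 A3 :: "real \<Rightarrow> complex^'n^'n" and y :: "complex^'n"
  assumes A2: "\<forall>i j. L2_on {-1..0} (\<lambda>s. A2 s $ i $ j)"
    and A3: "\<forall>i j. L2_on {-1..0} (\<lambda>s. A3 s $ i $ j)"
    and y: "cadj (Delta_A Am1 A2 A3 lam) *v y = 0"
  shows "\<exists>\<psi>. in_M2 \<psi> \<and> fst \<psi> = y \<and>
     (\<forall>x v. opA_rel Am1 A2 A3 x v \<longrightarrow> m2_inner v \<psi> = lam * m2_inner x \<psi>)"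
proof -
  let ?I = "{-1..0::real}"
  define a2 a3 where "a2 j s = (\<Sum>i\<in>UNIV. cnj (y $ i) * A2 s $ i $ j)"
    and "a3 j s = (\<Sum>i\<in>UNIV. cnj (y $ i) * A3 s $ i $ j)" for j s
  have a2: "L2_on ?I (a2 j)" and a3: "L2_on ?I (a3 j)" for j
    unfolding a2_def[abs_def] a3_def[abs_def] using A2 A3 by (auto intro!: L2_on_sum L2_on_cmult)
  define E where "E s = exp (lam * complex_of_real s)" for s
  define k where "k j s = a3 j s + lam * a2 j s" for j s
  have k: "L2_on ?I (k j)" for j unfolding k_def[abs_def] by (intro L2_on_add L2_on_cmult a2 a3)
  have Ec: "continuous_on X E" for X unfolding E_def[abs_def] by (intro continuous_intros)
  have int_E: "(\<lambda>s. E s * f s) absolutely_integrable_on ?I" if "L2_on ?I f" for f :: "real \<Rightarrow> complex"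
    by (rule L2_on_bilinear_integrable[OF L2_on_continuous[OF Ec] that bounded_bilinear_mult])
  \<comment> \<open>Q = exp(lam s) q turns the equation into Q' = exp(lam s) k with k = a3 + lam a2.
    The constant is chosen so that the condition at 0 holds; the condition at -1 is then no longer
    free.\<close>
  define Q where "Q j s = lam * cnj (y $ j) - integral ?I (\<lambda>s. E s * k j s) + integral {-1..s} (\<lambda>s. E s * k j s)" for j s
  have Q: "AC_with (-1) 0 (Q j) (\<lambda>s. E s * k j s)" for j
    using int_E[OF k] unfolding AC_with_def by (auto simp: Q_def)
  define q where "q j s = exp (- lam * complex_of_real s) * Q j s" for j s
  have AE: "AC_with (-1) 0 (\<lambda>s. exp (- lam * complex_of_real s)) (\<lambda>s. - lam * exp (- lam * complex_of_real s))"
    by (rule AC_with_C1)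
       (auto intro!: derivative_eq_intros has_vector_derivative_real_field continuous_intros)
  have q: "AC_with (-1) 0 (q j) (\<lambda>s. k j s - lam * q j s)" for j
  proof -
    have "(\<lambda>s. - lam * exp (- lam * complex_of_real s) * Q j s + exp (- lam * complex_of_real s) * (E s * k j s))
       = (\<lambda>s. k j s - lam * q j s)"
      by (auto simp: q_def E_def exp_minus field_simps)
    then show ?thesis using AC_with_mult[OF AE Q[of j]] by (simp add: q_def[abs_def])
  qed
  have q_right: "q j 0 = lam * cnj (y $ j)" for j by (simp add: q_def Q_def)
  have q_left: "q j (-1) = lam * (\<Sum>i\<in>UNIV. cnj (y $ i) * complex_of_real (Am1 $ i $ j))" for j
  proof -
    have sum: "integral ?I (\<lambda>s. E s * (\<Sum>i\<in>UNIV. cnj (y $ i) * A s $ i $ j)) =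
        (\<Sum>i\<in>UNIV. cnj (y $ i) * integral ?I (\<lambda>s. E s * A s $ i $ j))"
      if A: "\<forall>i j. L2_on ?I (\<lambda>s. A s $ i $ j)" for A :: "real \<Rightarrow> complex^'n^'n"
    proof -
      have i: "(\<lambda>s. E s * A s $ i $ j) integrable_on ?I" for i
        using int_E A by (simp add: absolutely_integrable_on_def)
      have "integral ?I (\<lambda>s. E s * (\<Sum>i\<in>UNIV. cnj (y $ i) * A s $ i $ j)) =
          integral ?I (\<lambda>s. \<Sum>i\<in>UNIV. cnj (y $ i) * (E s * A s $ i $ j))"
        by (simp add: sum_distrib_left mult_ac)
      also have "\<dots> = (\<Sum>i\<in>UNIV. integral ?I (\<lambda>s. cnj (y $ i) * (E s * A s $ i $ j)))"
        by (intro Henstock_Kurzweil_Integration.integral_sum) (auto intro: integrable_on_mult_right i)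
      finally show ?thesis by simp
    qed
    have "integral ?I (\<lambda>s. E s * k j s) = integral ?I (\<lambda>s. E s * a3 j s + lam * (E s * a2 j s))"
      by (simp add: k_def algebra_simps)
    also have "\<dots> = integral ?I (\<lambda>s. E s * a3 j s) + lam * integral ?I (\<lambda>s. E s * a2 j s)"
      using int_E[OF a3] int_E[OF a2]
      by (subst Henstock_Kurzweil_Integration.integral_add) (auto simp: absolutely_integrable_on_def intro: integrable_on_mult_right)
    also have "\<dots> = (\<Sum>i\<in>UNIV. cnj (y $ i) * integral ?I (\<lambda>s. E s * A3 s $ i $ j))
        + lam * (\<Sum>i\<in>UNIV. cnj (y $ i) * integral ?I (\<lambda>s. E s * A2 s $ i $ j))"
      unfolding a2_def a3_def by (simp add: sum[OF A2] sum[OF A3])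
    finally have intk: "integral ?I (\<lambda>s. E s * k j s) = \<dots>" .
    \<comment> \<open>The hypothesis on the adjoint matrix, conjugated, says that the j-th entry of
      y* \<Delta>(lam) is zero. It determines Q(-1); the factor exp(- lam) of the delay term cancels
      when passing from Q to q.\<close>
    have "0 = cnj ((cadj (Delta_A Am1 A2 A3 lam) *v y) $ j)" by (simp add: y)
    also have "\<dots> = (\<Sum>i\<in>UNIV. Delta_A Am1 A2 A3 lam $ i $ j * cnj (y $ i))"
      by (simp add: cadj_def matrix_vector_mult_def)
    also have "\<dots> = (\<Sum>i\<in>UNIV. (if i = j then lam * cnj (y $ i) else 0)
       - lam * exp (- lam) * (cnj (y $ i) * complex_of_real (Am1 $ i $ j))
       - lam * (cnj (y $ i) * integral ?I (\<lambda>s. E s * A2 s $ i $ j))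
       - cnj (y $ i) * integral ?I (\<lambda>s. E s * A3 s $ i $ j))"
      by (intro sum.cong refl) (simp add: Delta_A_def E_def algebra_simps)
    also have "\<dots> = lam * cnj (y $ j) - lam * exp (- lam) * (\<Sum>i\<in>UNIV. cnj (y $ i) * complex_of_real (Am1 $ i $ j))
       - integral ?I (\<lambda>s. E s * k j s)"
      unfolding intk by (simp add: sum_subtractf sum.distrib sum_distrib_left algebra_simps)
    finally have "Q j (-1) = lam * exp (- lam) * (\<Sum>i\<in>UNIV. cnj (y $ i) * complex_of_real (Am1 $ i $ j))"
      by (simp add: Q_def algebra_simps)
    then show ?thesis by (simp add: q_def exp_minus)
  qed
  have qL2: "L2_on ?I (q j)" for j by (rule L2_on_continuous[OF AC_with_continuous[OF q]])
  define p where "p j s = q j s - a2 j s" for j s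
  have p: "L2_on ?I (p j)" for j unfolding p_def[abs_def] by (intro L2_on_diff qL2 a2)
  define \<psi> :: "'n m2" where "\<psi> = (y, \<lambda>s. \<chi> j. cnj (p j s))"
  have \<psi>: "in_M2 \<psi>" using p by (simp add: in_M2_def \<psi>_def L2_on_vec_iff L2_on_cnj)
  have "m2_inner v \<psi> = lam * m2_inner x \<psi>" if xv: "opA_rel Am1 A2 A3 x v" for x v
  proof -
    obtain c w where w: "L2_on ?I w" and x_ae: "AE \<theta> in lebesgue. \<theta> \<in> ?I \<longrightarrow> snd x \<theta> = c + integral {-1..\<theta>} w"
      and fx: "fst x = (c + integral ?I w) - cmat Am1 *v (c + integral {-1..-1} w)"
      and fv: "fst v = integral ?I (\<lambda>\<theta>. A2 \<theta> *v w \<theta>) + integral ?I (\<lambda>\<theta>. A3 \<theta> *v (c + integral {-1..\<theta>} w))"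
      and sv: "snd v = w"
      using xv unfolding opA_rel_def Let_def by blast
    define z where "z \<theta> = c + integral {-1..\<theta>} w" for \<theta>
    have zAC: "AC_with (-1) 0 (\<lambda>t. z t $ j) (\<lambda>t. w t $ j)" for j
      unfolding z_def by (rule AC_with_indefinite_integral[OF w])
    have z: "L2_on ?I z"
      unfolding L2_on_vec_iff by (intro allI L2_on_continuous AC_with_continuous[OF zAC])
    have wj: "L2_on ?I (\<lambda>s. w s $ j)" and zj: "L2_on ?I (\<lambda>s. z s $ j)" for j
      using w z by (auto simp: L2_on_vec_iff)
    have prod: "(\<lambda>s. f s * g s) absolutely_integrable_on ?I" if "L2_on ?I f" "L2_on ?I g" for f g :: "real \<Rightarrow> complex"
      using that by (intro L2_on_bilinear_integrable bounded_bilinear_mult)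
    have prodi: "(\<lambda>s. f s * g s) integrable_on ?I" if "L2_on ?I f" "L2_on ?I g" for f g :: "real \<Rightarrow> complex"
      using prod[OF that] by (simp add: absolutely_integrable_on_def)
    have sum_int: "integral ?I (\<lambda>s. \<Sum>j\<in>UNIV. f j s * g s $ j) = (\<Sum>j\<in>UNIV. integral ?I (\<lambda>s. f j s * g s $ j))"
      if "\<And>j. L2_on ?I (f j)" "L2_on ?I g" for f :: "'n \<Rightarrow> real \<Rightarrow> complex" and g :: "real \<Rightarrow> complex^'n"
      using that by (intro Henstock_Kurzweil_Integration.integral_sum) (auto intro!: prodi simp: L2_on_vec_iff)
    have inner_int: "(LINT \<theta>:?I|lebesgue. (\<Sum>j\<in>UNIV. g \<theta> $ j * cnj (snd \<psi> \<theta> $ j)))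
       = (\<Sum>j\<in>UNIV. integral ?I (\<lambda>s. p j s * g s $ j))" if g: "L2_on ?I g" for g
    proof -
      have "(\<lambda>\<theta>. \<Sum>j\<in>UNIV. g \<theta> $ j * cnj (snd \<psi> \<theta> $ j)) absolutely_integrable_on ?I"
        using in_M2_sum_integrable[of "(0, g)" \<psi>] g \<psi> by (simp add: in_M2_def)
      then have "(LINT \<theta>:?I|lebesgue. (\<Sum>j\<in>UNIV. g \<theta> $ j * cnj (snd \<psi> \<theta> $ j)))
        = integral ?I (\<lambda>\<theta>. \<Sum>j\<in>UNIV. g \<theta> $ j * cnj (snd \<psi> \<theta> $ j))"
        by (rule set_lebesgue_integral_eq_integral(2))
      also have "\<dots> = integral ?I (\<lambda>\<theta>. \<Sum>j\<in>UNIV. p j \<theta> * g \<theta> $ j)"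
        by (simp add: \<psi>_def mult.commute)
      finally show ?thesis using sum_int[OF p g] by simp
    qed
    \<comment> \<open>The given second component is only almost everywhere equal to z, and z is the
      representative that has boundary values.\<close>
    have xz: "m2_inner x \<psi> = m2_inner (fst x, z) \<psi>"
      using x_ae z opA_rel_in_M2(1)[OF xv] by (intro m2_inner_cong \<psi>) (auto simp: in_M2_def m2_equiv_def z_def)
    have x_eq: "m2_inner x \<psi> = (\<Sum>i\<in>UNIV. fst x $ i * cnj (y $ i)) + (\<Sum>j\<in>UNIV. integral ?I (\<lambda>s. p j s * z s $ j))"
      unfolding xz unfolding m2_inner_def fst_conv snd_conv inner_int[OF z] by (simp add: \<psi>_def)
    have v_eq: "m2_inner v \<psi> = (\<Sum>j\<in>UNIV. integral ?I (\<lambda>s. a2 j s * w s $ j)) + (\<Sum>j\<in>UNIV. integral ?I (\<lambda>s. a3 j s * z s $ j))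
       + (\<Sum>j\<in>UNIV. integral ?I (\<lambda>s. p j s * w s $ j))"
    proof -
      have "(\<Sum>i\<in>UNIV. fst v $ i * cnj (y $ i)) = (\<Sum>i\<in>UNIV. integral ?I (\<lambda>\<theta>. A2 \<theta> *v w \<theta>) $ i * cnj (y $ i))
         + (\<Sum>i\<in>UNIV. integral ?I (\<lambda>\<theta>. A3 \<theta> *v z \<theta>) $ i * cnj (y $ i))"
        unfolding fv z_def by (simp add: distrib_right sum.distrib)
      also have "\<dots> = integral ?I (\<lambda>s. \<Sum>j\<in>UNIV. a2 j s * w s $ j) + integral ?I (\<lambda>s. \<Sum>j\<in>UNIV. a3 j s * z s $ j)"
        unfolding integral_matrix_vector_functional[OF A2 w] integral_matrix_vector_functional[OF A3 z] a2_def a3_def ..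
      finally show ?thesis
        unfolding m2_inner_def sv inner_int[OF w] sum_int[OF a2 w] sum_int[OF a3 z] by (simp add: \<psi>_def)
    qed
    have parts: "q j 0 * z 0 $ j = q j (-1) * z (-1) $ j + (integral ?I (\<lambda>s. a3 j s * z s $ j)
        - lam * integral ?I (\<lambda>s. p j s * z s $ j) + integral ?I (\<lambda>s. a2 j s * w s $ j) + integral ?I (\<lambda>s. p j s * w s $ j))" for j
    proof -
      have "q j 0 * z 0 $ j = q j (-1) * z (-1) $ j + integral ?I (\<lambda>s. (k j s - lam * q j s) * z s $ j + q j s * w s $ j)"
        by (rule AC_with_mult[OF q[of j] zAC[of j], unfolded AC_with_def, THEN conjunct2, THEN bspec]) simp
      \<comment> \<open>Since k = a3 + lam a2 and q = p + a2, the terms lam a2 cancel and k - lam q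
        becomes a3 - lam p.\<close>
      also have "(\<lambda>s. (k j s - lam * q j s) * z s $ j + q j s * w s $ j) =
         (\<lambda>s. (a3 j s * z s $ j - lam * (p j s * z s $ j)) + (a2 j s * w s $ j + p j s * w s $ j))"
        by (auto simp: k_def p_def algebra_simps)
      also have "integral ?I \<dots> = integral ?I (\<lambda>s. a3 j s * z s $ j) - lam * integral ?I (\<lambda>s. p j s * z s $ j)
         + (integral ?I (\<lambda>s. a2 j s * w s $ j) + integral ?I (\<lambda>s. p j s * w s $ j))"
        using prodi[OF a3 zj] prodi[OF p zj] prodi[OF a2 wj] prodi[OF p wj]
        by (simp add: Henstock_Kurzweil_Integration.integral_add Henstock_Kurzweil_Integration.integral_diff
            integrable_add integrable_diff integrable_on_mult_right)
      finally show ?thesis by simp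
    qed
    have "m2_inner v \<psi> - lam * (\<Sum>j\<in>UNIV. integral ?I (\<lambda>s. p j s * z s $ j)) =
        (\<Sum>j\<in>UNIV. q j 0 * z 0 $ j - q j (-1) * z (-1) $ j)"
      unfolding v_eq parts by (simp add: sum.distrib sum_subtractf sum_distrib_left)
    also have "\<dots> = lam * ((\<Sum>j\<in>UNIV. z 0 $ j * cnj (y $ j))
       - (\<Sum>j\<in>UNIV. \<Sum>i\<in>UNIV. cnj (y $ i) * complex_of_real (Am1 $ i $ j) * z (-1) $ j))"
      unfolding q_left q_right by (simp add: sum_subtractf sum_distrib_left sum_distrib_right algebra_simps)
    also have "(\<Sum>j\<in>UNIV. \<Sum>i\<in>UNIV. cnj (y $ i) * complex_of_real (Am1 $ i $ j) * z (-1) $ j)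
       = (\<Sum>i\<in>UNIV. (cmat Am1 *v z (-1)) $ i * cnj (y $ i))"
      by (subst sum.swap) (simp add: matrix_vector_mult_def cmat_def sum_distrib_left mult_ac)
    also have "(\<Sum>j\<in>UNIV. z 0 $ j * cnj (y $ j)) - \<dots> = (\<Sum>i\<in>UNIV. fst x $ i * cnj (y $ i))"
      unfolding fx by (simp add: z_def sum_subtractf left_diff_distrib)
    finally show ?thesis unfolding x_eq by (simp add: algebra_simps)
  qed
  then show ?thesis using \<psi> by (intro exI[of _ \<psi>]) (auto simp: \<psi>_def)
qed

subsection \<open>Approximation of (b, 0) by elements of the domain\<close>

text \<open>The value at -1 is 0 and the value at 0 is b, so z(0) - A_{-1} z(-1) = b. This is where
  k \<ge> 1 enters: for k = 0 the profile is the constant b, also at -1.\<close>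

lemma power_profile_in_domain:
  fixes b :: "complex^'n::finite"
  assumes k: "k \<ge> 1"
  shows "\<exists>v. opA_rel Am1 A2 A3 (b, \<lambda>\<theta>. (1 + \<theta>)^k *\<^sub>R b) v"
proof -
  let ?z = "\<lambda>\<theta>::real. (1 + \<theta>)^k *\<^sub>R b"
  define w where "w \<theta> = (real k * (1 + \<theta>)^(k - 1)) *\<^sub>R b" for \<theta>
  have wc: "continuous_on X w" for X unfolding w_def by (intro continuous_intros)
  have zc: "continuous_on X ?z" for X by (intro continuous_intros)
  have der: "(?z has_vector_derivative w \<theta>) (at \<theta> within X)" for \<theta> X
    unfolding w_def by (auto intro!: derivative_eq_intros)
  have int: "integral {-1..\<theta>} w = ?z \<theta>" if "-1 \<le> \<theta>" for \<theta>
  proof -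
    have "(w has_integral (?z \<theta> - ?z (-1))) {-1..\<theta>}"
      by (rule fundamental_theorem_of_calculus[OF that der])
    then show ?thesis using k by (simp add: integral_unique)
  qed
  have "opA_rel Am1 A2 A3 (b, ?z) (integral {-1..0} (\<lambda>\<theta>. A2 \<theta> *v w \<theta>)
           + integral {-1..0} (\<lambda>\<theta>. A3 \<theta> *v (0 + integral {-1..\<theta>} w)), w)"
    unfolding opA_rel_def Let_def
  proof (intro conjI exI[of _ 0] exI[of _ w])
    show "in_M2 (b, ?z)" by (simp add: in_M2_def L2_on_continuous[OF zc])
    show "L2_on {-1..0} w" by (rule L2_on_continuous[OF wc])
    show "AE \<theta> in lebesgue. \<theta> \<in> {-1..0} \<longrightarrow> snd (b, ?z) \<theta> = 0 + integral {-1..\<theta>} w"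
      by (auto simp: int)
    show "fst (b, ?z) = (0 + integral {-1..0} w) - cmat Am1 *v (0 + integral {-1..-1} w)"
      by (simp add: int)
  qed auto
  then show ?thesis by blast
qed

lemma m2_norm_power_profile:
  fixes b :: "complex^'n::finite"
  shows "m2_norm (m2_diff (b, \<lambda>\<theta>. (1 + \<theta>)^k *\<^sub>R b) (b, \<lambda>_. 0)) = norm b / sqrt (real (2 * k + 1))"
proof -
  have "((\<lambda>\<theta>::real. (1 + \<theta>)^n) has_integral ((1 + 0)^Suc n / real (Suc n) - (1 + (-1))^Suc n / real (Suc n))) {-1..0}" for n
  proof (rule fundamental_theorem_of_calculus)
    fix t :: real
    have "((\<lambda>\<theta>::real. (1 + \<theta>)^Suc n / real (Suc n)) has_real_derivative (1 + t)^n) (at t within {-1..0})"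
      by (rule derivative_eq_intros refl | simp del: power_Suc of_nat_Suc)+
    then show "((\<lambda>\<theta>::real. (1 + \<theta>)^Suc n / real (Suc n)) has_vector_derivative (1 + t)^n) (at t within {-1..0})"
      by (simp add: has_real_derivative_iff_has_vector_derivative)
  qed simp
  from this[of "2 * k"] have I: "integral {-1..0} (\<lambda>\<theta>::real. (1 + \<theta>)^(2 * k)) = 1 / real (2 * k + 1)"
    by (simp add: integral_unique)
  have "(\<lambda>\<theta>::real. (1 + \<theta>)^(2 * k)) absolutely_integrable_on {-1..0}"
    by (intro absolutely_integrable_continuous_real continuous_intros)
  from set_lebesgue_integral_eq_integral(2)[OF this]
  have "(LINT \<theta>:{-1..0}|lebesgue. (1 + \<theta>)^(2 * k)) = 1 / real (2 * k + 1)" by (simp add: I)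
  moreover have "(norm ((1 + \<theta>)^k *\<^sub>R b))^2 = norm b ^ 2 * (1 + \<theta>)^(2 * k)" for \<theta> :: real
    by (simp add: power_mult_distrib power_even_abs mult.commute power_mult flip: power_abs)
  ultimately have "m2_norm (m2_diff (b, \<lambda>\<theta>. (1 + \<theta>)^k *\<^sub>R b) (b, \<lambda>_. 0)) = sqrt (norm b ^ 2 * (1 / real (2 * k + 1)))"
    by (simp add: m2_norm_def m2_diff_def)
  then show ?thesis by (simp add: real_sqrt_mult real_sqrt_divide)
qed

text \<open>Approximates the control direction (b, 0), which is outside D(A) for b \<noteq> 0, by
  elements of D(A). The exponent is \<open>Suc k\<close> so that every member of the sequence
  belongs to D(A).\<close>

lemma power_profile_tendsto:
  fixes b :: "complex^'n::finite"
  shows "(\<lambda>k. m2_norm (m2_diff (b, \<lambda>\<theta>. (1 + \<theta>)^Suc k *\<^sub>R b) (b, \<lambda>_. 0))) \<longlonglongrightarrow> 0"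
proof -
  have "filterlim (\<lambda>k. 2 * Suc k + 1) at_top sequentially"
    by (rule filterlim_subseq) (auto intro: strict_monoI)
  then have "filterlim (\<lambda>k. sqrt (real (2 * Suc k + 1))) at_top sequentially"
    by (intro filterlim_compose[OF sqrt_at_top] filterlim_compose[OF filterlim_real_sequentially])
  then have "(\<lambda>k. norm b / sqrt (real (2 * Suc k + 1))) \<longlonglongrightarrow> 0"
    by (intro tendsto_divide_0[OF tendsto_const] filterlim_at_top_imp_at_infinity)
  then show ?thesis unfolding m2_norm_power_profile .
qed

lemma in_M2_power_profile: "in_M2 (b, \<lambda>\<theta>. (1 + \<theta>)^k *\<^sub>R b)" and in_M2_zero_profile: "in_M2 (b, \<lambda>_. 0)"
  by (auto simp: in_M2_def intro!: L2_on_continuous continuous_intros)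

lemma m2_inner_tendsto:
  assumes x: "\<And>k. in_M2 (x k)" "in_M2 x'" "in_M2 \<psi>" and lim: "(\<lambda>k. m2_norm (m2_diff (x k) x')) \<longlonglongrightarrow> 0"
  shows "(\<lambda>k. m2_inner (x k) \<psi>) \<longlonglongrightarrow> m2_inner x' \<psi>"
proof (rule Lim_transform2[OF tendsto_const, rotated])
  show "(\<lambda>k. m2_inner x' \<psi> - m2_inner (x k) \<psi>) \<longlonglongrightarrow> 0"
  proof (rule Lim_null_comparison)
    show "\<forall>\<^sub>F k in sequentially. norm (m2_inner x' \<psi> - m2_inner (x k) \<psi>) \<le> 2 * m2_norm \<psi> * m2_norm (m2_diff (x k) x')"
      using m2_inner_bound[OF in_M2_diff[OF x(1,2)] x(3)] x
      by (auto intro!: always_eventually simp: m2_inner_diff_left norm_minus_commute)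
    show "(\<lambda>k. 2 * m2_norm \<psi> * m2_norm (m2_diff (x k) x')) \<longlonglongrightarrow> 0"
      using tendsto_mult_left[OF lim] by simp
  qed
qed

section \<open>Reachable states are orthogonal to the adjoint eigenvector\<close>

theorem theorem2:
  fixes Am1 :: "real^'n::finite^'n"
    and B :: "real^'r::finite^'n"
    and A2 A3 :: "real \<Rightarrow> complex^'n^'n"
    and S :: "real \<Rightarrow> 'n m2 \<Rightarrow> 'n m2"
  assumes A2_L2: "\<forall>i j. L2_on {-1..0} (\<lambda>s. A2 s $ i $ j)"
    and A3_L2: "\<forall>i j. L2_on {-1..0} (\<lambda>s. A3 s $ i $ j)"
    and gen: "generated_by_A Am1 A2 A3 S"
    and eig: "\<exists>lam (y::complex^'n). y \<noteq> 0 \<and> cadj (Delta_A Am1 A2 A3 lam) *v y = 0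
                  \<and> cadj (cmat B) *v y = 0"
  shows "\<forall>T>0. reach_set S B T \<noteq> dom_A Am1 A2 A3"
proof -
  obtain lam y where y: "y \<noteq> 0" "cadj (Delta_A Am1 A2 A3 lam) *v y = 0" "cadj (cmat B) *v y = 0"
    using eig by blast
  obtain \<psi> where \<psi>: "in_M2 \<psi>" "fst \<psi> = y"
    and adj: "\<And>x v. opA_rel Am1 A2 A3 x v \<Longrightarrow> m2_inner v \<psi> = lam * m2_inner x \<psi>"
    using adjoint_eigenvector_exists[OF A2_L2 A3_L2 y(2)] by blast
  have S: "is_C0_semigroup S" using gen by (simp add: generated_by_A_def)
  let ?x = "\<lambda>b k. (b, \<lambda>\<theta>. (1 + \<theta>)^Suc k *\<^sub>R b) :: 'n m2"
  \<comment> \<open>For fixed t both sides are continuous in the state with respect to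
    \<open>m2_norm\<close>, because S(t) is bounded; the law on D(A) thus passes to the limit (b,
    0).\<close>
  have orbit: "m2_inner (S t (b, \<lambda>_. 0)) \<psi> = exp (lam * complex_of_real t) * m2_inner (b, \<lambda>_. 0) \<psi>"
    if t: "t \<ge> 0" for t b
  proof -
    have ex: "m2_inner (S t (?x b k)) \<psi> = exp (lam * complex_of_real t) * m2_inner (?x b k) \<psi>" for k
      using power_profile_in_domain[of "Suc k" Am1 A2 A3 b] m2_inner_orbit_eq_exp[OF gen \<psi>(1) adj _ t] by auto
    obtain M where M: "\<And>x. in_M2 x \<Longrightarrow> m2_norm (S t x) \<le> M * m2_norm x" using sg_bounded[OF S t] by blast
    have le: "m2_norm (m2_diff (S t (?x b k)) (S t (b, \<lambda>_. 0))) \<le> M * m2_norm (m2_diff (?x b k) (b, \<lambda>_. 0))" for k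
    proof -
      note ins = in_M2_power_profile[of b "Suc k"] in_M2_zero_profile[of b]
      have "m2_norm (m2_diff (S t (?x b k)) (S t (b, \<lambda>_. 0))) = m2_norm (S t (m2_diff (?x b k) (b, \<lambda>_. 0)))"
        by (rule m2_norm_cong[OF in_M2_diff[OF sg_in_M2[OF S t ins(1)] sg_in_M2[OF S t ins(2)]]
              sg_in_M2[OF S t in_M2_diff[OF ins]] m2_equiv_sym[OF sg_diff[OF S t ins]]])
      then show ?thesis using M[OF in_M2_diff[OF ins]] by simp
    qed
    have "(\<lambda>k. M * m2_norm (m2_diff (?x b k) (b, \<lambda>_. 0))) \<longlonglongrightarrow> 0"
      using tendsto_mult_left[OF power_profile_tendsto[of b], of M] by simp
    then have "(\<lambda>k. m2_norm (m2_diff (S t (?x b k)) (S t (b, \<lambda>_. 0)))) \<longlonglongrightarrow> 0"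
      by (rule Lim_null_comparison[rotated]) (use le in \<open>auto intro: always_eventually\<close>)
    then have "(\<lambda>k. m2_inner (S t (?x b k)) \<psi>) \<longlonglongrightarrow> m2_inner (S t (b, \<lambda>_. 0)) \<psi>"
      by (intro m2_inner_tendsto sg_in_M2[OF S t] in_M2_power_profile in_M2_zero_profile \<psi>)
    moreover have "(\<lambda>k. m2_inner (S t (?x b k)) \<psi>) \<longlonglongrightarrow> exp (lam * complex_of_real t) * m2_inner (b, \<lambda>_. 0) \<psi>"
      unfolding ex
      by (intro tendsto_mult_left m2_inner_tendsto in_M2_power_profile in_M2_zero_profile \<psi> power_profile_tendsto)
    ultimately show ?thesis by (rule LIMSEQ_unique)
  qed
  \<comment> \<open>The second component vanishes, so the pairing reduces to (B u, y), which is the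
    pairing of u with B* y = 0.\<close>
  have zero: "m2_inner (cmat B *v u, \<lambda>_. 0) \<psi> = 0" for u
  proof -
    have "m2_inner (cmat B *v u, \<lambda>_. 0) \<psi> = (\<Sum>i\<in>UNIV. \<Sum>j\<in>UNIV. u $ j * (complex_of_real (B $ i $ j) * cnj (y $ i)))"
      by (simp add: m2_inner_def \<psi> matrix_vector_mult_def cmat_def sum_distrib_left sum_distrib_right mult_ac)
    also have "\<dots> = (\<Sum>j\<in>UNIV. u $ j * (\<Sum>i\<in>UNIV. complex_of_real (B $ i $ j) * cnj (y $ i)))"
      by (subst sum.swap) (simp add: sum_distrib_left)
    also have "\<dots> = (\<Sum>j\<in>UNIV. u $ j * cnj ((cadj (cmat B) *v y) $ j))"
      by (simp add: cadj_def cmat_def matrix_vector_mult_def)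
    finally show ?thesis by (simp add: y)
  qed
  \<comment> \<open>Taking b = y makes the limit of the pairings |y|^2, so a profile with large k is
    a state of D(A) that is not orthogonal to \<psi>.\<close>
  have "(\<lambda>k. m2_inner (?x y k) \<psi>) \<longlonglongrightarrow> m2_inner (y, \<lambda>_. 0) \<psi>"
    by (intro m2_inner_tendsto in_M2_power_profile in_M2_zero_profile \<psi> power_profile_tendsto)
  moreover have "m2_inner (y, \<lambda>_. 0) \<psi> \<noteq> 0"
    using y(1) by (simp add: m2_inner_def \<psi> sum_mult_cnj_eq_inner complex_eq_iff)
  ultimately have "\<forall>\<^sub>F k in sequentially. m2_inner (?x y k) \<psi> \<noteq> 0" by (rule tendsto_imp_eventually_ne)
  then obtain k where k: "m2_inner (?x y k) \<psi> \<noteq> 0" by (auto simp: eventually_sequentially)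
  have dom: "?x y k \<in> dom_A Am1 A2 A3"
    using power_profile_in_domain[of "Suc k" Am1 A2 A3 y] by (simp add: dom_A_def del: power_Suc)
  \<comment> \<open>\<psi> itself is the test element in the weak description of the integral. The
    integrand is zero at every t in [0,T], whatever the control u.\<close>
  have "m2_inner x \<psi> = 0" if xr: "x \<in> reach_set S B T" for x T
  proof -
    obtain u where "m2_inner x \<psi> = (LINT t:{0..T}|lebesgue. m2_inner (S t (cmat B *v u t, \<lambda>_. 0)) \<psi>)"
      using xr \<psi>(1) unfolding reach_set_def by blast
    also have "\<dots> = (LINT t:{0..T}|lebesgue. 0)"
      unfolding set_lebesgue_integral_def
      by (rule Bochner_Integration.integral_cong) (auto simp: indicator_def orbit zero)
    finally show ?thesis by simp
  qed
  then show ?thesis using dom k by blast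
qed

end
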